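(* Let $w^{AW,H}$ be the weight system on the lecture hall graph defined, for $m\ge0$ and $0\le j\le i$, by \[ w^{AW,H}(t;i,j)=\frac12(abcd\,q^{2i})^mq^j\times\begin{cases} a & \text{if } t=8m=0,\\ -a^{-1}q^{-i} & \text{if } t=8m\ne0,\\ b & \text{if } t=8m+1,\\ c & \text{if } t=8m+2,\\ -abc\,q^i & \text{if } t=8m+3,\\ d & \text{if } t=8m+4,\\ -abd\,q^i & \text{if } t=8m+5,\\ -acd\,q^i & \text{if } t=8m+6,\\ a^2bcd\,q^{2i} & \text{if } t=8m+7.\end{cases} \] Then for all $n\ge k\ge0$, \[ h^{w^{AW,H}}_{n,k}=\sigma^{AW,H}_{n,k}(a,b,c,d;q), \] where $\sigma^{AW,H}_{n,k}(a,b,c,d;q)$ are the mixed moments of the Askey--Wilson polynomials relative to the continuous $q$-Hermite polynomials.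
   Context: Lecture hall graph. For integers $t\ge0$, $0\le j\le i$ put $v^t_{i,j}=(i,\,t+\frac{j}{i+1})$, and set $v^t_{i,i+1}:=v^{t+1}_{i,0}$. The vertices of the lecture hall graph are all $v^t_{i,j}$; its edges join $v^t_{i,j}$ with $v^t_{i,j+1}$ (vertical edges) and $v^t_{i,j}$ with $v^t_{i+1,j}$, for $t\ge 0$, $0\le j\le i$. An east step is a directed edge $(v^t_{i,j},v^t_{i+1,j})$; a south step is a vertical edge directed downwards, $(v^t_{i,j+1},v^t_{i,j})$. A weight system $w$ assigns a weight $w(t;i,j)$ to each east step $(v^t_{i,j},v^t_{i+1,j})$. The weight $w(p)$ of a path is the product of the weights of its east steps. $\mathrm{SE}((k,\infty)\to(n,0))$ is the set of paths $(\dots,v_2,v_1,v_0)$ with $v_0=(n,0)$, $\lim_{m\to\infty}v_m=(k,\infty)$, and each $(v_{m+1},v_m)$ a south or east step. Define $h^w_{n,k}=\sum_{p\in \mathrm{SE}((k,\infty)\to(n,0))}w(p)$ (so $h^w_{n,n}=1$). Polynomials. Write $(z;q)_n=\prod_{i=0}^{n-1}(1-zq^i)$, $(z_1,\dots,z_r;q)_n=\prod_s(z_s;q)_n$, and ${}_r\phi_s(\alpha_1,\dots,\alpha_r;\beta_1,\dots,\beta_s;q,z)=\sum_{k\ge0}\frac{(\alpha_1,\dots,\alpha_r;q)_k}{(q,\beta_1,\dots,\beta_s;q)_k}\big((-1)^kq^{\binom k2}\big)^{1+s-r}z^k$. With $x=\cos\theta$, the monic Askey--Wilson polynomials are \[ p_n(x;a,b,c,d|q)=\frac{(ab,ac,ad;q)_n}{2^na^n(abcdq^{n-1};q)_n}\;{}_4\phi_3\!\left(\begin{matrix}q^{-n},\,abcdq^{n-1},\,ae^{\mathbf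 i\theta},\,ae^{-\mathbf i\theta}\\ ab,\,ac,\,ad\end{matrix};q,q\right), \] and the monic continuous $q$-Hermite polynomials are $H_n(x|q)=\frac{e^{\mathbf in\theta}}{2^n}\,{}_2\phi_0\!\left(\begin{matrix}q^{-n},0\\-\end{matrix};q,q^ne^{-2\mathbf i\theta}\right)$. The mixed moments $\sigma^{AW,H}_{n,k}$ are defined by $H_n(x|q)=\sum_{k=0}^n\sigma^{AW,H}_{n,k}(a,b,c,d;q)\,p_k(x;a,b,c,d|q)$. Here $a,b,c,d,q$ are indeterminates and the identity is one of formal power series in $a,b,c,d$ with coefficients in $\mathbb{Q}(q)$. *)

theory Defs
  imports
    "HOL-Analysis.Infinite_Sum"
    "HOL-Computational_Algebra.Computational_Algebra"
begin

section \<open>The lecture hall graph\<close>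

type_synonym vertex = "nat \<times> real"

text \<open>
  The convention for the index \<open>j = i + 1\<close> holds automatically: \<open>lh_vertex t i (Suc i)\<close> and
  \<open>lh_vertex (Suc t) i 0\<close> are the same point of the plane.
\<close>

definition lh_vertex :: "nat \<Rightarrow> nat \<Rightarrow> nat \<Rightarrow> vertex" where
  "lh_vertex t i j = (i, real t + real j / (real i + 1))"

definition east_steps :: "(vertex \<times> vertex) set" where
  "east_steps = {(lh_vertex t i j, lh_vertex t (Suc i) j) | t i j. j \<le> i}"

definition south_steps :: "(vertex \<times> vertex) set" where
  "south_steps = {(lh_vertex t i (Suc j), lh_vertex t i j) | t i j. j \<le> i}"

text \<open>
  A path \<open>(\<dots>, v\<^sub>2, v\<^sub>1, v\<^sub>0)\<close> is the sequence \<open>v\<close> of its vertices, numbered from its end point.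
\<close>

definition SE_paths :: "nat \<Rightarrow> nat \<Rightarrow> (nat \<Rightarrow> vertex) set" where
  "SE_paths k n =
     {v. v 0 = (n, 0)
       \<and> (\<forall>m. (v (Suc m), v m) \<in> east_steps \<union> south_steps)
       \<and> (\<lambda>m. fst (v m)) \<longlonglongrightarrow> k
       \<and> filterlim (\<lambda>m. snd (v m)) at_top sequentially}"

text \<open>
  An east step determines its index \<open>(t, i, j)\<close> with \<open>j \<le> i\<close>, and a path in \<open>SE_paths k n\<close>
  uses exactly \<open>n - k\<close> east steps, none of them twice. So the product of the weights of the
  east steps of the path is a finite product over the set of their indices.
\<close>

definition east_indices :: "(nat \<Rightarrow> vertex) \<Rightarrow> (nat \<times> nat \<times> nat) set" where
  "east_indices v =
     {(t, i, j). j \<le> i \<and> (\<exists>m. v (Suc m) = lh_vertex t i j \<and> v m = lh_vertex t (Suc i) j)}"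

definition path_weight ::
    "(nat \<Rightarrow> nat \<Rightarrow> nat \<Rightarrow> 'a) \<Rightarrow> (nat \<Rightarrow> vertex) \<Rightarrow> 'a::comm_monoid_mult" where
  "path_weight w v = (\<Prod>(t, i, j)\<in>east_indices v. w t i j)"

definition lh_sum ::
    "(nat \<Rightarrow> nat \<Rightarrow> nat \<Rightarrow> 'a) \<Rightarrow> nat \<Rightarrow> nat \<Rightarrow> 'a::{comm_semiring_1, t2_space}" where
  "lh_sum w n k = infsum (path_weight w) (SE_paths k n)"


section \<open>Basic hypergeometric series and orthogonal polynomials\<close>

definition qpoch :: "'a::comm_ring_1 \<Rightarrow> 'a \<Rightarrow> nat \<Rightarrow> 'a" where
  "qpoch z q n = (\<Prod>i<n. 1 - z * q ^ i)"

definition qpochs :: "'a::comm_ring_1 list \<Rightarrow> 'a \<Rightarrow> nat \<Rightarrow> 'a" where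
  "qpochs zs q n = (\<Prod>z\<leftarrow>zs. qpoch z q n)"

definition qhyper :: "'a list \<Rightarrow> 'a list \<Rightarrow> 'a \<Rightarrow> 'a \<Rightarrow> 'a::{field, t2_space}" where
  "qhyper \<alpha>s \<beta>s q z =
     (\<Sum>k. qpochs \<alpha>s q k / qpochs (q # \<beta>s) q k
        * ((-1) ^ k * q ^ (k choose 2)) powi (1 + int (length \<beta>s) - int (length \<alpha>s))
        * z ^ k)"

text \<open>
  The polynomial in \<open>x = cos \<theta>\<close> given by an expression \<open>F\<close> in \<open>z = e\<^sup>i\<^sup>\<theta>\<close>. In an infinite field
  the values at all \<open>x = (z + z\<^sup>-\<^sup>1) / 2\<close> determine a polynomial, see \<open>cos_poly_eqI\<close> below.
\<close>

definition cos_poly :: "('a \<Rightarrow> 'a) \<Rightarrow> 'a::field poly" where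
  "cos_poly F = (THE P. \<forall>z. z \<noteq> 0 \<longrightarrow> poly P ((z + inverse z) / 2) = F z)"

definition askey_wilson :: "'a \<Rightarrow> 'a \<Rightarrow> 'a \<Rightarrow> 'a \<Rightarrow> 'a \<Rightarrow> nat \<Rightarrow> 'a::{field, t2_space} poly" where
  "askey_wilson a b c d q n = cos_poly (\<lambda>z.
     qpochs [a * b, a * c, a * d] q n
       / (2 ^ n * a ^ n * qpoch (a * b * c * d * q powi (int n - 1)) q n)
     * qhyper [q powi (- int n), a * b * c * d * q powi (int n - 1), a * z, a * inverse z]
         [a * b, a * c, a * d] q q)"

definition q_hermite :: "'a \<Rightarrow> nat \<Rightarrow> 'a::{field, t2_space} poly" where
  "q_hermite q n = cos_poly (\<lambda>z.
     z ^ n / 2 ^ n * qhyper [q powi (- int n), 0] [] q (q ^ n * z powi (- 2)))"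

text \<open>
  The mixed moments of \<open>P\<close> relative to \<open>Q\<close>: the coefficients of \<open>Q n\<close> in the basis
  \<open>P 0, \<dots>, P n\<close>. They are set to \<open>0\<close> beyond \<open>n\<close>, so that the coefficient sequence is unique.
\<close>

definition mixed_moment :: "(nat \<Rightarrow> 'a::field poly) \<Rightarrow> (nat \<Rightarrow> 'a poly) \<Rightarrow> nat \<Rightarrow> nat \<Rightarrow> 'a" where
  "mixed_moment P Q n =
     (THE \<sigma>. Q n = (\<Sum>k\<le>n. smult (\<sigma> k) (P k)) \<and> (\<forall>k>n. \<sigma> k = 0))"

definition w_AWH :: "'a \<Rightarrow> 'a \<Rightarrow> 'a \<Rightarrow> 'a \<Rightarrow> 'a \<Rightarrow> nat \<Rightarrow> nat \<Rightarrow> nat \<Rightarrow> 'a::field" where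
  "w_AWH a b c d q t i j =
     (let m = t div 8 in
      1 / 2 * (a * b * c * d * q ^ (2 * i)) ^ m * q ^ j *
      (if t = 8 * m \<and> m = 0 then a
       else if t = 8 * m then - inverse a * q powi (- int i)
       else if t = 8 * m + 1 then b
       else if t = 8 * m + 2 then c
       else if t = 8 * m + 3 then - a * b * c * q ^ i
       else if t = 8 * m + 4 then d
       else if t = 8 * m + 5 then - a * b * d * q ^ i
       else if t = 8 * m + 6 then - a * c * d * q ^ i
       else a\<^sup>2 * b * c * d * q ^ (2 * i)))"


section \<open>The indeterminates\<close>

text \<open>
  The type \<open>aw_field\<close> is the field of iterated formal Laurent series
  \<open>\<rat>(q)((d))((c))((b))((a))\<close>, an extension of the ring \<open>\<rat>(q)[[a,b,c,d]]\<close> in which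
  \<open>a\<close> is invertible, so that all expressions above can be read literally. An
  identity between elements of \<open>\<rat>(q)[[a,b,c,d]]\<close> holds there iff it holds in \<open>aw_field\<close>. The
  library topology on \<open>aw_field\<close> is the \<open>a\<close>-adic one. For the weights \<open>w_AWH\<close>, all path
  weights lie in \<open>\<rat>(q)[[a,b,c,d]]\<close>, and only finitely many of them have \<open>a\<close>-order below a given
  bound (the step weights with \<open>t \<ge> 8 m\<close> and \<open>m > 0\<close> are divisible by \<open>a\<^sup>m\<^sup>-\<^sup>1\<close>), so their sum is the
  usual coefficientwise sum of formal power series.
\<close>

type_synonym aw_field = "rat poly fract fls fls fls fls"

definition X_a :: aw_field where
  "X_a = fls_X"

definition X_b :: aw_field where
  "X_b = fls_const fls_X"

definition X_c :: aw_field where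
  "X_c = fls_const (fls_const fls_X)"

definition X_d :: aw_field where
  "X_d = fls_const (fls_const (fls_const fls_X))"

definition X_q :: aw_field where
  "X_q = fls_const (fls_const (fls_const (fls_const (Fract [:0, 1:] 1))))"


section \<open>Well-definedness of the polynomials in the cosine\<close>

lemma cos_poly_eqI:
  fixes P :: "'a::field_char_0 poly"
  assumes "\<And>z. z \<noteq> 0 \<Longrightarrow> poly P ((z + inverse z) / 2) = F z"
  shows "cos_poly F = P"
  unfolding cos_poly_def
proof (rule the_equality)
  show "\<forall>z. z \<noteq> 0 \<longrightarrow> poly P ((z + inverse z) / 2) = F z"
    using assms by blast
next
  fix R :: "'a poly"
  assume R: "\<forall>z. z \<noteq> 0 \<longrightarrow> poly R ((z + inverse z) / 2) = F z"
  define f :: "nat \<Rightarrow> 'a" where "f n = (of_nat (Suc n) + inverse (of_nat (Suc n))) / 2" for n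
  have "inj f"
  proof (rule injI)
    fix m n assume eq: "f m = f n"
    define u v :: 'a where "u = of_nat (Suc m)" and "v = of_nat (Suc n)"
    have nz: "u \<noteq> 0" "v \<noteq> 0"
      unfolding u_def v_def by (simp_all only: of_nat_eq_0_iff nat.simps not_False_eq_True)
    have "u + inverse u = 2 * f m" "v + inverse v = 2 * f n"
      by (simp_all add: f_def u_def v_def del: of_nat_Suc)
    hence "u + inverse u = v + inverse v"
      using eq by simp
    hence "(u - v) * (u * v - 1) = 0"
      using nz by (simp add: field_simps)
    hence "u = v \<or> u * v = 1" by simp
    moreover have "u * v = 1 \<Longrightarrow> u = v"
    proof -
      assume "u * v = 1"
      hence "(of_nat (Suc m * Suc n) :: 'a) = of_nat 1"
        unfolding u_def v_def by (simp only: of_nat_mult of_nat_1)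
      hence "Suc m * Suc n = 1" by (simp only: of_nat_eq_iff)
      hence "m = n" by simp
      thus "u = v" by (simp add: u_def v_def)
    qed
    ultimately have "u = v" by blast
    thus "m = n" unfolding u_def v_def by (simp only: of_nat_eq_iff nat.inject)
  qed
  have "range f \<subseteq> {x. poly (R - P) x = 0}"
    using R assms by (auto simp: f_def simp del: of_nat_Suc)
  hence "infinite {x. poly (R - P) x = 0}"
    using \<open>inj f\<close> by (meson finite_subset range_inj_infinite)
  thus "R = P"
    using poly_roots_finite[of "R - P"] by auto
qed

end

theory Submission
  imports Defs
begin

text \<open>
  Cut the graph at integer heights. With weights \<open>u\<^sub>t(i) q\<^sup>j\<close>, the level between the heights
  \<open>t\<close> and \<open>t + 1\<close> acts on sequences by the triangular matrix with entries
  \<open>u\<^sub>t(l) \<cdots> u\<^sub>t(n - 1)\<close> times a \<open>q\<close>-binomial coefficient, and the path sums are the entries of the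
  infinite product of these matrices. By the \<open>q\<close>-binomial theorem, the levels with weights \<open>u(i)\<close> and
  \<open>- x q\<^sup>i u(i)\<close> together act like one level with weight \<open>(1 - x q\<^sup>i) u(i)\<close>. In this way the eight
  levels from \<open>8m + 4\<close> on collapse to
  \<open>d/2 (abcd q\<^sup>2\<^sup>i)\<^sup>m (1 - ab q\<^sup>i) (1 - ac q\<^sup>i) (1 - bc q\<^sup>i)\<close>, and the finite form of the Durfee square
  identity multiplies all these blocks: the result is the connection matrix from the Askey--Wilson
  polynomials with parameters \<open>(a, b, c, 0)\<close> to those with parameters \<open>(a, b, c, d)\<close>. The same
  connection formula with fewer parameters explains level 1 and the levels 2 and 3, and level 0 connects
  the continuous \<open>q\<close>-Hermite polynomials with the parameters \<open>(a, 0, 0, 0)\<close>.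
\<close>

section \<open>Gaussian binomial coefficients\<close>

text \<open>The factor \<open>(a * b * c * d * q ^ (2 * i)) ^ m\<close> has its origin in the
  denominators \<open>1 - a * b * c * d * q ^ (k + i)\<close> of the connection matrix for d. They
  depend on the column k as well as on i, so the matrix is not a single level. The Durfee identity
  splits off one level that carries the numerators as weights and leaves a matrix of the same shape,
  with every weight multiplied by abcd q^(2i). Repeating this produces one block for each m.

  No infinite product is ever formed. After m blocks the identity is still exact, with an explicit
  remaining column \<open>block_col\<close>. That column differs from a unit column only in a-adic
  order m, and the same order bounds the weight of every path with an east step in level 8m + 4 or
  above.

  The parameter a is exceptional: the expansion of the Askey--Wilson polynomials divides by powers
  of a. It therefore cannot be switched on by the connection formula, and the passage from the
  q-Hermite polynomials to (a, 0, 0, 0) rests on three-term recurrences instead.\<close>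

fun qbinom :: "'a::comm_ring_1 \<Rightarrow> nat \<Rightarrow> nat \<Rightarrow> 'a" where
  "qbinom q n 0 = 1"
| "qbinom q 0 (Suc k) = 0"
| "qbinom q (Suc n) (Suc k) = qbinom q n k + q ^ Suc k * qbinom q n (Suc k)"

text \<open>This is (q;q)_n, without the division by (1 - q)^n that the usual q-factorial
  carries.\<close>

definition qfact :: "'a::comm_ring_1 \<Rightarrow> nat \<Rightarrow> 'a" where
  "qfact q n = (\<Prod>i<n. 1 - q ^ Suc i)"

lemma qfact_0 [simp]: "qfact q 0 = 1"
  by (simp add: qfact_def)

lemma qfact_Suc: "qfact q (Suc n) = (1 - q ^ Suc n) * qfact q n"
  by (simp add: qfact_def mult.commute)

lemma qbinom_eq_0: "n < k \<Longrightarrow> qbinom q n k = 0"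
  by (induction q n k rule: qbinom.induct) auto

lemma qbinom_self [simp]: "qbinom q n n = 1"
  by (induction n) (simp_all add: qbinom_eq_0)

text \<open>The two Pascal terms contribute the two parts of 1 - q^(k+l) = (1 - q^k) + q^k (1 -
  q^l). The multiplicative form keeps the identity valid in every commutative ring.\<close>

lemma qbinom_qfact: "qbinom q (k + l) k * qfact q k * qfact q l = qfact q (k + l)"
proof (induction "k + l" arbitrary: k l)
  case 0
  then show ?case by simp
next
  case (Suc m)
  show ?case
  proof (cases k)
    case 0
    then show ?thesis by simp
  next
    case k: (Suc k')
    show ?thesis
    proof (cases l)
      case 0
      then show ?thesis using k by simp
    next
      case l: (Suc l')
      have 1: "qbinom q (k' + l) k' * qfact q k' * qfact q l = qfact q m"
        using Suc(1)[of k' l] Suc(2) k by simp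
      have 2: "qbinom q (k + l') k * qfact q k * qfact q l' = qfact q m"
        using Suc(1)[of k l'] Suc(2) l by simp
      have eq: "k + l = Suc (k' + l)" "k + l' = k' + l" "m = k' + l"
        using Suc(2) k l by auto
      have "qbinom q (k + l) k * qfact q k * qfact q l
          = (1 - q ^ k) * (qbinom q (k' + l) k' * qfact q k' * qfact q l)
            + q ^ k * (1 - q ^ l) * (qbinom q (k + l') k * qfact q k * qfact q l')"
        unfolding eq(1) unfolding k qbinom.simps eq(2) using eq(2)
        by (simp add: k l qfact_Suc algebra_simps)
      also have "\<dots> = (1 - q ^ (k + l)) * qfact q m"
        unfolding 1 2 by (simp add: algebra_simps power_add)
      also have "\<dots> = qfact q (k + l)"
        using eq by (simp add: qfact_Suc)
      finally show ?thesis .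
    qed
  qed
qed

locale generic_q =
  fixes q :: "'a::field"
  assumes q_nz: "q \<noteq> 0" and q_pow: "\<And>m. q ^ Suc m \<noteq> 1"
begin

abbreviation qb :: "nat \<Rightarrow> nat \<Rightarrow> 'a" where
  "qb \<equiv> qbinom q"

lemma one_minus_q_pow: "1 - q ^ Suc m \<noteq> 0"
  using q_pow[of m] by simp

lemma qfact_nz [simp]: "qfact q n \<noteq> 0"
  by (induction n) (use q_pow in \<open>simp_all add: qfact_Suc del: power_Suc\<close>)

lemma qb_add: "qb (k + l) k = qfact q (k + l) / (qfact q k * qfact q l)"
  using qbinom_qfact[of q k l] by (simp add: field_simps)

lemma qb_eq: "k \<le> n \<Longrightarrow> qb n k = qfact q n / (qfact q k * qfact q (n - k))"
  using qb_add[of k "n - k"] by simp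

text \<open>The mirror image of the defining Pascal rule. The truncated \<open>n - k\<close> does no
  harm, because \<open>qb n k\<close> is 0 for k > n.\<close>

lemma qb_Suc_Suc': "qb (Suc n) (Suc k) = qb n (Suc k) + q ^ (n - k) * qb n k"
proof (cases "k < n")
  case True
  then obtain l where n: "n = k + Suc l"
    using less_imp_Suc_add by fastforce
  have 1: "qb (Suc n) (Suc k) = qfact q (Suc n) / (qfact q (Suc k) * qfact q (Suc l))"
    using qb_eq[of "Suc k" "Suc n"] n by simp
  have 2: "qb n (Suc k) = qfact q n / (qfact q (Suc k) * qfact q l)"
    using qb_eq[of "Suc k" n] n by simp
  have 3: "qb n k = qfact q n / (qfact q k * qfact q (Suc l))"
    using qb_eq[of k n] n by simp
  show ?thesis
    unfolding 1 2 3 qfact_Suc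
    using one_minus_q_pow[of k] one_minus_q_pow[of l]
    by (simp add: divide_simps n del: power_Suc)
       (simp add: algebra_simps power_add)
next
  case False
  then show ?thesis
    by (cases "k = n") (simp_all add: qbinom_eq_0)
qed

lemma qb_absorb: "(1 - q ^ Suc k) * qb (Suc n) (Suc k) = (1 - q ^ Suc n) * qb n k"
proof (cases "k \<le> n")
  case True
  then show ?thesis
    using one_minus_q_pow[of k]
    by (simp add: qb_eq qfact_Suc divide_simps del: power_Suc qbinom.simps)
next
  case False
  then show ?thesis by (simp add: qbinom_eq_0)
qed

lemma qb_absorb': "(1 - q ^ (Suc n - k)) * qb (Suc n) k = (1 - q ^ Suc n) * qb n k"
proof (cases "k \<le> n")
  case True
  then show ?thesis
    using one_minus_q_pow[of "n - k"]
    by (simp add: qb_eq qfact_Suc Suc_diff_le divide_simps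
        del: power_Suc qbinom.simps)
next
  case False
  then show ?thesis
    by (cases "k = Suc n") (simp_all add: qbinom_eq_0)
qed

lemma qb_trinomial:
  assumes "k \<le> j" "j \<le> n"
  shows "qb n j * qb j k = qb n k * qb (n - k) (j - k)"
  using assms by (simp add: qb_eq)

lemma qb_symmetric: "k \<le> n \<Longrightarrow> qb n (n - k) = qb n k"
  by (simp add: qb_eq)

text \<open>The mirrored Pascal rule trades row N + 1 for row N at the price of a combined summand.
  In \<open>qb_theorem\<close> and \<open>durfee_sum\<close> that summand is again a combination of
  summands of row N with coefficients free of r, which makes induction on N work.\<close>

lemma sum_qb_Suc:
  "(\<Sum>r\<le>Suc N. qb (Suc N) r * f r) = (\<Sum>r\<le>N. qb N r * (f r + q ^ (N - r) * f (Suc r)))"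
proof -
  have "(\<Sum>r\<le>Suc N. qb (Suc N) r * f r)
      = f 0 + (\<Sum>r\<le>N. qb N (Suc r) * f (Suc r)) + (\<Sum>r\<le>N. q ^ (N - r) * qb N r * f (Suc r))"
    by (simp add: sum.atMost_Suc_shift qb_Suc_Suc' algebra_simps sum.distrib
        del: sum.atMost_Suc qbinom.simps(3))
  also have "f 0 + (\<Sum>r\<le>N. qb N (Suc r) * f (Suc r)) = (\<Sum>r\<le>Suc N. qb N r * f r)"
    by (simp add: sum.atMost_Suc_shift del: sum.atMost_Suc)
  also have "\<dots> = (\<Sum>r\<le>N. qb N r * f r)"
    by (simp add: qbinom_eq_0)
  finally show ?thesis
    by (simp add: sum.distrib algebra_simps)
qed

text \<open>The weights are chosen such that both parts of the sum are independent of \<open>r\<close> when the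
  very-well-poised summand of \<open>well_poised_sum\<close> is inserted.\<close>

lemma sum_qb_Suc_poised:
  "(1 - Z * q ^ N) * (\<Sum>r\<le>Suc N. qb (Suc N) r * f r)
     = (\<Sum>r\<le>N. qb N r * ((1 - Z * q ^ (N + r)) * f r + (q ^ (N - r) - Z * q ^ N) * f (Suc r)))"
proof -
  have step: "(1 - Z * q ^ N) * qb (Suc N) (Suc r)
      = (1 - Z * q ^ (N + Suc r)) * qb N (Suc r) + (q ^ (N - r) - Z * q ^ N) * qb N r" for r
  proof -
    have "qb N (Suc r) + q ^ (N - r) * qb N r = qb N r + q ^ Suc r * qb N (Suc r)"
      using qb_Suc_Suc'[of N r] by simp
    then have "Z * q ^ N * (qb N (Suc r) + q ^ (N - r) * qb N r)
        = Z * q ^ N * (qb N r + q ^ Suc r * qb N (Suc r))"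
      by simp
    then show ?thesis
      unfolding qb_Suc_Suc' by (simp add: algebra_simps power_add)
  qed
  have "(1 - Z * q ^ N) * (\<Sum>r\<le>Suc N. qb (Suc N) r * f r)
      = (1 - Z * q ^ N) * f 0 + (\<Sum>r\<le>N. (1 - Z * q ^ N) * qb (Suc N) (Suc r) * f (Suc r))"
    by (simp add: sum.atMost_Suc_shift sum_distrib_left algebra_simps
        del: sum.atMost_Suc qbinom.simps(3))
  also have "\<dots> = (\<Sum>r\<le>Suc N. (1 - Z * q ^ (N + r)) * qb N r * f r)
      + (\<Sum>r\<le>N. (q ^ (N - r) - Z * q ^ N) * qb N r * f (Suc r))"
    unfolding step by (simp add: sum.atMost_Suc_shift sum.distrib ring_distribs
        del: sum.atMost_Suc)
  also have "(\<Sum>r\<le>Suc N. (1 - Z * q ^ (N + r)) * qb N r * f r)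
      = (\<Sum>r\<le>N. (1 - Z * q ^ (N + r)) * qb N r * f r)"
    by (simp add: qbinom_eq_0)
  also have "\<dots> + (\<Sum>r\<le>N. (q ^ (N - r) - Z * q ^ N) * qb N r * f (Suc r))
      = (\<Sum>r\<le>N. qb N r * ((1 - Z * q ^ (N + r)) * f r + (q ^ (N - r) - Z * q ^ N) * f (Suc r)))"
    unfolding sum.distrib[symmetric] by (intro sum.cong refl) (simp only: ring_distribs mult_ac)
  finally show ?thesis .
qed

text \<open>The product on the left is (-x)^r q^(r choose 2). Since q^(N-r) times the new factor -x
  q^r is -x q^N, the combined summand is the old one times 1 - x q^N.\<close>

lemma qb_theorem: "(\<Sum>r\<le>N. qb N r * (\<Prod>i<r. - x * q ^ i)) = (\<Prod>i<N. 1 - x * q ^ i)"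
proof (induction N)
  case 0
  then show ?case by simp
next
  case (Suc N)
  have "(\<Sum>r\<le>Suc N. qb (Suc N) r * (\<Prod>i<r. - x * q ^ i))
      = (\<Sum>r\<le>N. (1 - x * q ^ N) * (qb N r * (\<Prod>i<r. - x * q ^ i)))"
    unfolding sum_qb_Suc
  proof (rule sum.cong[OF refl])
    fix r assume "r \<in> {..N}"
    then have "q ^ N = q ^ (N - r) * q ^ r"
      by (simp flip: power_add)
    then show "qb N r * ((\<Prod>i<r. - x * q ^ i) + q ^ (N - r) * (\<Prod>i<Suc r. - x * q ^ i))
        = (1 - x * q ^ N) * (qb N r * (\<Prod>i<r. - x * q ^ i))"
      by (simp add: algebra_simps)
  qed
  then show ?case
    using Suc by (simp add: sum_distrib_left[symmetric])
qed

text \<open>Divided by (x;q)_N and taken at x = q, this counts partitions with at most N parts by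
  their Durfee square. The second Pascal part is the same sum at x q, hence the induction for
  arbitrary x; the two parts enter with the factors 1 - x q^N and x q^N.\<close>

lemma durfee_sum:
  "(\<Sum>r\<le>N. qb N r * ((\<Prod>i<r. x * q ^ (2 * i)) * (\<Prod>i=r..<N. 1 - x * q ^ i))) = 1"
proof (induction N arbitrary: x)
  case 0
  then show ?case by simp
next
  case (Suc N)
  define f where "f N x r = (\<Prod>i<r. x * q ^ (2 * i)) * (\<Prod>i=r..<N. 1 - x * q ^ i)"
    for N x and r :: nat
  have "(\<Sum>r\<le>Suc N. qb (Suc N) r * f (Suc N) x r)
      = (\<Sum>r\<le>N. (1 - x * q ^ N) * (qb N r * f N x r) + x * q ^ N * (qb N r * f N (x * q) r))"
    unfolding sum_qb_Suc
  proof (rule sum.cong[OF refl])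
    fix r assume "r \<in> {..N}"
    then have r: "r \<le> N" by simp
    have 1: "f (Suc N) x r = (1 - x * q ^ N) * f N x r"
      using r by (simp add: f_def)
    have "f (Suc N) x (Suc r)
        = x * (\<Prod>i<r. q * (x * q * q ^ (2 * i))) * (\<Prod>i=r..<N. 1 - x * q * q ^ i)"
      unfolding f_def prod.lessThan_Suc_shift prod.atLeast_Suc_lessThan_Suc_shift
      by (simp add: comp_def algebra_simps)
    also have "\<dots> = x * q ^ r * f N (x * q) r"
      by (simp add: f_def prod.distrib[of "\<lambda>_. q"])
    finally have 2: "f (Suc N) x (Suc r) = x * q ^ r * f N (x * q) r" .
    have 3: "q ^ N = q ^ (N - r) * q ^ r"
      using r by (simp flip: power_add)
    show "qb N r * (f (Suc N) x r + q ^ (N - r) * f (Suc N) x (Suc r))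
      = (1 - x * q ^ N) * (qb N r * f N x r) + x * q ^ N * (qb N r * f N (x * q) r)"
      unfolding 1 2 3 by (simp add: algebra_simps)
  qed
  moreover have "(\<Sum>r\<le>N. qb N r * f N x r) = 1" for x
    using Suc[of x] by (simp only: f_def)
  ultimately have "(\<Sum>r\<le>Suc N. qb (Suc N) r * f (Suc N) x r) = 1"
    by (simp only: sum.distrib sum_distrib_left[symmetric]) simp
  then show ?case
    by (simp only: f_def)
qed

text \<open>The truncated \<open>r - 1\<close> differs from the true one only for \<open>r = 0\<close>, where the product is empty.\<close>

lemma well_poised_sum:
  assumes "\<And>m. y * w * q ^ m \<noteq> 1"
  shows "(\<Sum>r\<le>N. qb N r * ((\<Prod>i=r..<N. y * (1 - w * q ^ i) / (1 - y * w * q ^ (r + i)))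
           * (\<Prod>i<r. (1 - y * q ^ i) / (1 - y * w * q ^ (r - 1 + i))))) = 1"
  using assms
proof (induction N arbitrary: y w)
  case 0
  then show ?case by simp
next
  case (Suc N)
  define f where "f N y w r = (\<Prod>i=r..<N. y * (1 - w * q ^ i) / (1 - y * w * q ^ (r + i)))
           * (\<Prod>i<r. (1 - y * q ^ i) / (1 - y * w * q ^ (r - 1 + i)))"
    for N y w and r :: nat
  have nz: "1 - y * w * q ^ m \<noteq> 0" for m
    using Suc.prems[of m] by simp
  \<comment> \<open>The first part reproduces the sum for (y, w), the second the one for (yq, wq).
    Both are 1 by induction, and y (1 - w q^N) + (1 - y) = 1 - y w q^N restores the factor on the
    left.\<close>
  have "(1 - y * w * q ^ N) * (\<Sum>r\<le>Suc N. qb (Suc N) r * f (Suc N) y w r)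
      = (\<Sum>r\<le>N. y * (1 - w * q ^ N) * (qb N r * f N y w r)
          + (1 - y) * (qb N r * f N (y * q) (w * q) r))"
    unfolding sum_qb_Suc_poised
  proof (rule sum.cong[OF refl])
    fix r assume "r \<in> {..N}"
    then have r: "r \<le> N" by simp
    have 1: "(1 - y * w * q ^ (N + r)) * f (Suc N) y w r = y * (1 - w * q ^ N) * f N y w r"
      using r nz[of "N + r"] by (simp add: f_def add.commute)
    have "(\<Prod>i<Suc r. (1 - y * q ^ i) / (1 - y * w * q ^ (r + i)))
        = (1 - y) / (1 - y * w * q ^ r)
          * (\<Prod>i<r. (1 - (y * q) * q ^ i) / (1 - (y * q) * (w * q) * q ^ (r - 1 + i)))"
    proof -
      have "(\<Prod>i<r. (1 - y * q ^ Suc i) / (1 - y * w * q ^ (r + Suc i)))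
          = (\<Prod>i<r. (1 - (y * q) * q ^ i) / (1 - (y * q) * (w * q) * q ^ (r - 1 + i)))"
      proof (rule prod.cong[OF refl])
        fix i assume "i \<in> {..<r}"
        then have "r + Suc i = Suc (Suc (r - 1 + i))" by auto
        then show "(1 - y * q ^ Suc i) / (1 - y * w * q ^ (r + Suc i))
          = (1 - (y * q) * q ^ i) / (1 - (y * q) * (w * q) * q ^ (r - 1 + i))"
          by (simp only: power_Suc mult_ac)
      qed
      then show ?thesis
        unfolding prod.lessThan_Suc_shift by simp
    qed
    moreover have "q ^ (N - r) * (\<Prod>i=Suc r..<Suc N. y * (1 - w * q ^ i) / (1 - y * w * q ^ (Suc r + i)))
        = (\<Prod>i=r..<N. (y * q) * (1 - (w * q) * q ^ i) / (1 - (y * q) * (w * q) * q ^ (r + i)))"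
    proof -
      have "(\<Prod>i=r..<N. (y * q) * (1 - (w * q) * q ^ i) / (1 - (y * q) * (w * q) * q ^ (r + i)))
        = (\<Prod>i=r..<N. q * (y * (1 - w * q ^ Suc i) / (1 - y * w * q ^ (Suc r + Suc i))))"
        by (simp add: mult_ac)
      also have "\<dots> = q ^ (N - r)
          * (\<Prod>i=r..<N. y * (1 - w * q ^ Suc i) / (1 - y * w * q ^ (Suc r + Suc i)))"
        by (simp only: prod.distrib prod_constant card_atLeastLessThan)
      finally show ?thesis
        unfolding prod.atLeast_Suc_lessThan_Suc_shift by (simp add: comp_def)
    qed
    ultimately have 2: "q ^ (N - r) * f (Suc N) y w (Suc r)
        = (1 - y) / (1 - y * w * q ^ r) * f N (y * q) (w * q) r"
      unfolding f_def by (simp add: mult_ac)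
    have "(q ^ (N - r) - y * w * q ^ N) = (1 - y * w * q ^ r) * q ^ (N - r)"
      using r by (simp add: algebra_simps flip: power_add)
    then have 3: "(q ^ (N - r) - y * w * q ^ N) * f (Suc N) y w (Suc r)
        = (1 - y) * f N (y * q) (w * q) r"
      using 2 nz[of r] by (simp add: mult.assoc)
    show "qb N r * ((1 - y * w * q ^ (N + r)) * f (Suc N) y w r
          + (q ^ (N - r) - y * w * q ^ N) * f (Suc N) y w (Suc r))
      = y * (1 - w * q ^ N) * (qb N r * f N y w r)
          + (1 - y) * (qb N r * f N (y * q) (w * q) r)"
      unfolding 1 3 by (simp add: algebra_simps)
  qed
  also have "\<dots> = y * (1 - w * q ^ N) + (1 - y)"
  proof -
    have "(y * q) * (w * q) * q ^ m \<noteq> 1" for m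
      using Suc.prems[of "Suc (Suc m)"] by (simp add: mult_ac)
    then have "(\<Sum>r\<le>N. qb N r * f N (y * q) (w * q) r) = 1"
      unfolding f_def by (rule Suc.IH)
    moreover have "(\<Sum>r\<le>N. qb N r * f N y w r) = 1"
      unfolding f_def by (rule Suc.IH) (rule Suc.prems)
    ultimately show ?thesis
      by (simp only: sum.distrib sum_distrib_left[symmetric]) simp
  qed
  also have "\<dots> = 1 - y * w * q ^ N"
    by (simp add: algebra_simps)
  finally have "(\<Sum>r\<le>Suc N. qb (Suc N) r * f (Suc N) y w r) = 1"
    using nz[of N] by (simp only: mult_cancel_left2) simp
  then show ?case
    by (simp only: f_def)
qed

end

section \<open>Expansions of the Askey--Wilson polynomials\<close>

context generic_q
begin

section \<open>The coefficients of the 4phi3 series and the connection formula\<close>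

lemma qb_ratio: "(1 - q ^ Suc k) * qb n (Suc k) = (1 - q ^ (n - k)) * qb n k"
  using qb_Suc_Suc'[of n k] by (simp add: algebra_simps)

text \<open>This turns the terminating numerator of a basic hypergeometric series into a Gaussian
  binomial. For j > n both sides vanish, which later cuts the series off at n.\<close>

lemma qpoch_neg_power:
  "qpoch (q powi (- int n)) q j / qpoch q q j = qb n j * (\<Prod>i<j. - (q ^ i)) / q ^ (n * j)"
proof (induction j)
  case 0
  then show ?case by (simp add: qpoch_def)
next
  case (Suc j)
  have "qpoch (q powi (- int n)) q (Suc j) / qpoch q q (Suc j)
      = (qpoch (q powi (- int n)) q j / qpoch q q j)
        * ((1 - q powi (- int n) * q ^ j) / (1 - q ^ Suc j))"
    by (simp add: qpoch_def)
  also have "\<dots> = qb n j * (1 - q powi (- int n) * q ^ j) / (1 - q ^ Suc j)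
      * ((\<Prod>i<j. - (q ^ i)) / q ^ (n * j))"
    unfolding Suc by (simp add: mult_ac)
  also have "qb n j * (1 - q powi (- int n) * q ^ j)
      = (1 - q ^ Suc j) * qb n (Suc j) * (- (q ^ j) / q ^ n)"
  proof (cases "j \<le> n")
    case True
    then have "1 - q powi (- int n) * q ^ j = (1 - q ^ (n - j)) * (- (q ^ j) / q ^ n)"
      using q_nz by (simp add: power_int_minus field_simps flip: power_add)
    then show ?thesis
      unfolding qb_ratio by simp
  next
    case False
    then show ?thesis by (simp add: qbinom_eq_0)
  qed
  finally show ?case
    using one_minus_q_pow[of j] by (simp add: power_add mult_ac del: power_Suc)
qed

text \<open>The truncated \<open>n - 1\<close> is harmless: for \<open>n = 0\<close> the product is empty.\<close>

definition aw_coeff :: "'a \<Rightarrow> 'a \<Rightarrow> 'a \<Rightarrow> 'a \<Rightarrow> nat \<Rightarrow> nat \<Rightarrow> 'a" where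
  "aw_coeff a b c d n j =
     qb n j * (\<Prod>i<j. - (q ^ Suc i)) / ((2 * a) ^ n * q ^ (n * j))
     * (\<Prod>i=j..<n. (1 - a * b * q ^ i) * (1 - a * c * q ^ i) * (1 - a * d * q ^ i)
          / (1 - a * b * c * d * q ^ (n - 1 + i)))"

text \<open>This is (az;q)_j (a/z;q)_j as a polynomial in x = (z + 1/z)/2.\<close>

definition aw_basis :: "'a \<Rightarrow> nat \<Rightarrow> 'a poly" where
  "aw_basis a j = (\<Prod>i<j. [:1 + (a * q ^ i)\<^sup>2, - 2 * a * q ^ i:])"

text \<open>The quotients (ab;q)_n / (ab;q)_j of the hypergeometric form are already cancelled in
  the coefficients. Apart from powers of 2, a and q only factors with abcd remain as denominators,
  so the connection formula needs no conditions on ab, ac, ad.\<close>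

definition aw_poly :: "'a \<Rightarrow> 'a \<Rightarrow> 'a \<Rightarrow> 'a \<Rightarrow> nat \<Rightarrow> 'a poly" where
  "aw_poly a b c d n = (\<Sum>j\<le>n. smult (aw_coeff a b c d n j) (aw_basis a j))"

lemma aw_coeff_eq_0: "n < j \<Longrightarrow> aw_coeff a b c d n j = 0"
  by (simp add: aw_coeff_def qbinom_eq_0)

lemma poly_aw_poly:
  assumes "n \<le> K"
  shows "poly (aw_poly a b c d n) x = (\<Sum>j\<le>K. aw_coeff a b c d n j * poly (aw_basis a j) x)"
  unfolding aw_poly_def poly_sum poly_smult
  using assms by (intro sum.mono_neutral_left) (auto simp: aw_coeff_eq_0)

text \<open>The coefficients are visibly symmetric in b, c, d. These instances move a parameter that
  was just switched on out of the last place, where the connection formula creates it.\<close>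

lemma aw_poly_commute: "aw_poly a b 0 d = aw_poly a b d 0" "aw_poly a 0 0 d = aw_poly a d 0 0"
  by (auto intro!: ext simp: aw_poly_def aw_coeff_def mult_ac)

lemma poly_aw_basis:
  assumes "z \<noteq> 0" "(2::'a) \<noteq> 0"
  shows "poly (aw_basis a j) ((z + inverse z) / 2) = qpoch (a * z) q j * qpoch (a * inverse z) q j"
  unfolding aw_basis_def qpoch_def poly_prod prod.distrib[symmetric]
  using assms by (intro prod.cong refl) (simp add: power2_eq_square field_simps)

lemma
  assumes "a \<noteq> 0" "(2::'a) \<noteq> 0"
  shows degree_aw_basis: "degree (aw_basis a j) = j" and aw_basis_nz: "aw_basis a j \<noteq> 0"
proof -
  have *: "[:1 + (a * q ^ i)\<^sup>2, - 2 * a * q ^ i:] \<noteq> 0" for i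
    using assms q_nz by simp
  then show "aw_basis a j \<noteq> 0"
    unfolding aw_basis_def by (subst prod_zero_iff) blast+
  have "degree (aw_basis a j) = (\<Sum>i<j. degree [:1 + (a * q ^ i)\<^sup>2, - 2 * a * q ^ i:])"
    unfolding aw_basis_def using * by (intro degree_prod_eq_sum_degree) auto
  then show "degree (aw_basis a j) = j"
    using assms q_nz by simp
qed

lemma
  assumes "a \<noteq> 0" "(2::'a) \<noteq> 0"
  shows degree_aw_poly_le: "degree (aw_poly a b c d n) \<le> n" and coeff_aw_poly_nz: "coeff (aw_poly a b c d n) n \<noteq> 0"
proof -
  show "degree (aw_poly a b c d n) \<le> n"
    unfolding aw_poly_def using degree_aw_basis[OF assms]
    by (intro degree_sum_le) (auto intro: order.trans[OF degree_smult_le])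
  have "coeff (aw_basis a j) n = (if j = n then lead_coeff (aw_basis a n) else 0)" if "j \<le> n" for j
    using that degree_aw_basis[OF assms] by (auto intro: coeff_eq_0)
  then have "coeff (aw_poly a b c d n) n
      = (\<Sum>j\<le>n. if j = n then aw_coeff a b c d n n * lead_coeff (aw_basis a n) else 0)"
    unfolding aw_poly_def coeff_sum coeff_smult by (intro sum.cong refl) auto
  moreover have "aw_coeff a b c d n n \<noteq> 0"
    using assms q_nz by (simp add: aw_coeff_def)
  ultimately show "coeff (aw_poly a b c d n) n \<noteq> 0"
    using aw_basis_nz[OF assms, of n] by simp
qed

definition connection_coeff :: "'a \<Rightarrow> 'a \<Rightarrow> 'a \<Rightarrow> 'a \<Rightarrow> nat \<Rightarrow> nat \<Rightarrow> 'a" where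
  "connection_coeff a b c d n k =
     qb n k * (\<Prod>i=k..<n. d / 2 * (1 - a * b * q ^ i) * (1 - a * c * q ^ i) * (1 - b * c * q ^ i)
        / (1 - a * b * c * d * q ^ (k + i)))"

lemma connection_coeff_eq_0: "n < k \<Longrightarrow> connection_coeff a b c d n k = 0"
  by (simp add: connection_coeff_def qbinom_eq_0)

text \<open>This compares the coefficients of \<open>aw_basis a j\<close>. Each term is the
  right-hand side times a summand of \<open>well_poised_sum\<close> with N = n - j, y = ad q^j and w
  = bc q^j, and those summands add up to 1.\<close>

lemma aw_coeff_connection:
  assumes a: "a \<noteq> 0" and two: "(2::'a) \<noteq> 0" and D: "\<And>m. a * b * c * d * q ^ m \<noteq> 1"
    and j: "j \<le> n"
  shows "(\<Sum>k=j..n. connection_coeff a b c d n k * aw_coeff a b c d k j) = aw_coeff a b c 0 n j"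
proof -
  define y w where "y = a * d * q ^ j" and "w = b * c * q ^ j"
  define t where "t r = qb (n - j) r
      * ((\<Prod>i=r..<n - j. y * (1 - w * q ^ i) / (1 - y * w * q ^ (r + i)))
           * (\<Prod>i<r. (1 - y * q ^ i) / (1 - y * w * q ^ (r - 1 + i))))" for r
  have "y * w * q ^ m \<noteq> 1" for m
    using D[of "m + j + j"] by (simp add: y_def w_def power_add mult_ac)
  then have "(\<Sum>r\<le>n - j. t r) = 1"
    unfolding t_def by (rule well_poised_sum)
  moreover have "(\<Sum>k=j..n. t (k - j)) = (\<Sum>r\<le>n - j. t r)"
    using j by (intro sum.reindex_bij_witness[of _ "\<lambda>r. r + j" "\<lambda>k. k - j"]) auto
  ultimately have sum_t: "(\<Sum>k=j..n. t (k - j)) = 1" by simp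
  have "connection_coeff a b c d n k * aw_coeff a b c d k j = aw_coeff a b c 0 n j * t (k - j)"
    if k: "j \<le> k" "k \<le> n" for k
  proof -
    define s where "s i = (1 - a * b * q ^ i) * (1 - a * c * q ^ i)" for i
    have split: "(\<Prod>i=j..<n. s i) = (\<Prod>i=j..<k. s i) * (\<Prod>i=k..<n. s i)"
      using k by (simp add: prod.atLeastLessThan_concat)
    have shift1: "(\<Prod>i=k - j..<n - j. y * (1 - w * q ^ i) / (1 - y * w * q ^ (k - j + i)))
        = (\<Prod>i=k..<n. y * (1 - b * c * q ^ i) / (1 - a * b * c * d * q ^ (k + i)))"
    proof (rule prod.reindex_bij_witness[of _ "\<lambda>i. i - j" "\<lambda>i. i + j"])
      fix i assume "i \<in> {k - j..<n - j}"
      have "y * w * q ^ (k - j + i) = a * b * c * d * q ^ (k + (i + j))"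
        using k unfolding y_def w_def
        by (subst le_add_diff_inverse[OF k(1), symmetric]) (simp only: power_add mult_ac)
      moreover have "w * q ^ i = b * c * q ^ (i + j)"
        by (simp add: w_def power_add mult_ac)
      ultimately show "y * (1 - b * c * q ^ (i + j)) / (1 - a * b * c * d * q ^ (k + (i + j)))
          = y * (1 - w * q ^ i) / (1 - y * w * q ^ (k - j + i))" by simp
    qed (use k in auto)
    have shift2: "(\<Prod>i<k - j. (1 - y * q ^ i) / (1 - y * w * q ^ (k - j - 1 + i)))
        = (\<Prod>i=j..<k. (1 - a * d * q ^ i) / (1 - a * b * c * d * q ^ (k - 1 + i)))"
    proof (rule prod.reindex_bij_witness[of _ "\<lambda>i. i - j" "\<lambda>i. i + j"])
      fix i assume i: "i \<in> {..<k - j}"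
      then have e: "k - 1 = j + (k - j - 1)" by auto
      have "y * w * q ^ (k - j - 1 + i) = a * b * c * d * q ^ (k - 1 + (i + j))"
        unfolding e y_def w_def by (simp add: power_add mult_ac)
      moreover have "y * q ^ i = a * d * q ^ (i + j)"
        by (simp add: y_def power_add mult_ac)
      ultimately show "(1 - a * d * q ^ (i + j)) / (1 - a * b * c * d * q ^ (k - 1 + (i + j)))
          = (1 - y * q ^ i) / (1 - y * w * q ^ (k - j - 1 + i))" by simp
    qed (use k in auto)
    have "connection_coeff a b c d n k = qb n k * ((\<Prod>i=k..<n. s i)
        * (\<Prod>i=k..<n. y * (1 - b * c * q ^ i) / (1 - a * b * c * d * q ^ (k + i))))
        / ((2 * a) ^ (n - k) * q ^ ((n - k) * j))"
    proof -
      \<comment> \<open>Writing d/2 as y / (2 a q^j) yields exactly the powers of 2a and q^j by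
        which the prefactors of \<open>aw_coeff\<close> for n and for k differ.\<close>
      have "(\<Prod>i=k..<n. d / 2 * (1 - a * b * q ^ i) * (1 - a * c * q ^ i) * (1 - b * c * q ^ i)
          / (1 - a * b * c * d * q ^ (k + i)))
        = (\<Prod>i=k..<n. s i * (y * (1 - b * c * q ^ i) / (1 - a * b * c * d * q ^ (k + i)))
            * (1 / (2 * a * q ^ j)))"
        using a two q_nz by (intro prod.cong refl) (simp add: s_def y_def mult_ac)
      also have "\<dots> = (\<Prod>i=k..<n. s i)
          * (\<Prod>i=k..<n. y * (1 - b * c * q ^ i) / (1 - a * b * c * d * q ^ (k + i)))
          * (1 / (2 * a * q ^ j)) ^ (n - k)"
        by (simp only: prod.distrib prod_constant card_atLeastLessThan)
      also have "(1 / (2 * a * q ^ j)) ^ (n - k) = 1 / ((2 * a) ^ (n - k) * q ^ ((n - k) * j))"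
        by (simp add: power_divide power_mult_distrib power_mult[symmetric] mult.commute)
      finally show ?thesis
        by (simp add: connection_coeff_def)
    qed
    moreover have "aw_coeff a b c d k j = qb k j * (\<Prod>i<j. - (q ^ Suc i))
        / ((2 * a) ^ k * q ^ (k * j)) * ((\<Prod>i=j..<k. s i)
        * (\<Prod>i=j..<k. (1 - a * d * q ^ i) / (1 - a * b * c * d * q ^ (k - 1 + i))))"
      unfolding aw_coeff_def prod.distrib[symmetric] by (simp add: s_def)
    moreover have "aw_coeff a b c 0 n j = qb n j * (\<Prod>i<j. - (q ^ Suc i))
        / ((2 * a) ^ n * q ^ (n * j)) * (\<Prod>i=j..<n. s i)"
      by (simp add: aw_coeff_def s_def)
    moreover have "(2 * a) ^ n = (2 * a) ^ (n - k) * (2 * a) ^ k"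
      using k by (simp only: power_add[symmetric] le_add_diff_inverse2)
    moreover have "q ^ (n * j) = q ^ ((n - k) * j) * q ^ (k * j)"
      using k by (simp add: diff_mult_distrib flip: power_add)
    moreover define h where "h = 2 * a"
    ultimately show ?thesis
      using qb_trinomial[OF k] a two q_nz
      unfolding t_def shift1 shift2 split h_def[symmetric] by (simp add: mult_ac)
  qed
  then have "(\<Sum>k=j..n. connection_coeff a b c d n k * aw_coeff a b c d k j)
      = (\<Sum>k=j..n. aw_coeff a b c 0 n j * t (k - j))"
    by (intro sum.cong refl) auto
  then show ?thesis
    using sum_t by (simp add: sum_distrib_left[symmetric])
qed

lemma aw_poly_connection:
  assumes "a \<noteq> 0" "(2::'a) \<noteq> 0" "\<And>m. a * b * c * d * q ^ m \<noteq> 1"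
  shows "poly (aw_poly a b c 0 n) x
    = (\<Sum>k\<le>n. connection_coeff a b c d n k * poly (aw_poly a b c d k) x)"
proof -
  have "(\<Sum>k\<le>n. connection_coeff a b c d n k * poly (aw_poly a b c d k) x)
      = (\<Sum>k\<le>n. connection_coeff a b c d n k
          * (\<Sum>j\<le>n. aw_coeff a b c d k j * poly (aw_basis a j) x))"
    by (intro sum.cong refl) (simp add: poly_aw_poly)
  also have "\<dots> = (\<Sum>j\<le>n. (\<Sum>k\<le>n. connection_coeff a b c d n k * aw_coeff a b c d k j)
      * poly (aw_basis a j) x)"
    unfolding sum_distrib_left sum_distrib_right mult.assoc by (rule sum.swap)
  also have "\<dots> = (\<Sum>j\<le>n. aw_coeff a b c 0 n j * poly (aw_basis a j) x)"
  proof (intro sum.cong refl)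
    fix j assume j: "j \<in> {..n}"
    have "(\<Sum>k\<le>n. connection_coeff a b c d n k * aw_coeff a b c d k j)
        = (\<Sum>k=j..n. connection_coeff a b c d n k * aw_coeff a b c d k j)"
      by (intro sum.mono_neutral_right) (auto simp: aw_coeff_eq_0)
    then show "(\<Sum>k\<le>n. connection_coeff a b c d n k * aw_coeff a b c d k j)
          * poly (aw_basis a j) x = aw_coeff a b c 0 n j * poly (aw_basis a j) x"
      using aw_coeff_connection[OF assms, of j n] j by simp
  qed
  finally show ?thesis
    by (simp add: poly_aw_poly)
qed

section \<open>Continuous q-Hermite and big q-Hermite polynomials through their recurrences\<close>

fun hermite_poly :: "nat \<Rightarrow> 'a poly" where
  "hermite_poly 0 = 1"
| "hermite_poly (Suc 0) = [:0, 1:]"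
| "hermite_poly (Suc (Suc n)) =
     [:0, 1:] * hermite_poly (Suc n) - smult ((1 - q ^ Suc n) / 4) (hermite_poly n)"

definition rogers_szego :: "'a \<Rightarrow> 'a \<Rightarrow> nat \<Rightarrow> 'a" where
  "rogers_szego u v n = (\<Sum>k\<le>n. qb n k * (u ^ (n - k) * v ^ k))"

text \<open>In the combined summand of \<open>sum_qb_Suc\<close>, q^(N-r) is written as 1 - (1 -
  q^(N-r)). The first part gives the factor u + v, and absorption lowers the second part to row
  n.\<close>

lemma rogers_szego_rec:
  "rogers_szego u v (Suc (Suc n))
     = (u + v) * rogers_szego u v (Suc n) - (1 - q ^ Suc n) * (u * v) * rogers_szego u v n"
proof -
  let ?N = "Suc n"
  have "rogers_szego u v (Suc ?N)
      = (\<Sum>r\<le>?N. qb ?N r * (u ^ (Suc ?N - r) * v ^ r + q ^ (?N - r) * (u ^ (?N - r) * v ^ Suc r)))"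
    unfolding rogers_szego_def sum_qb_Suc by simp
  also have "\<dots> = (\<Sum>r\<le>?N. (u + v) * (qb ?N r * (u ^ (?N - r) * v ^ r))
      - (1 - q ^ (?N - r)) * qb ?N r * (u ^ (?N - r) * v ^ Suc r))"
    by (intro sum.cong refl) (auto simp: Suc_diff_le algebra_simps simp del: qbinom.simps)
  also have "\<dots> = (u + v) * rogers_szego u v ?N
      - (\<Sum>r\<le>?N. (1 - q ^ ?N) * qb n r * (u ^ (?N - r) * v ^ Suc r))"
    unfolding qb_absorb' sum_subtractf rogers_szego_def sum_distrib_left ..
  also have "(\<Sum>r\<le>?N. (1 - q ^ ?N) * qb n r * (u ^ (?N - r) * v ^ Suc r))
      = (1 - q ^ ?N) * (u * v) * rogers_szego u v n"
    by (simp add: qbinom_eq_0 rogers_szego_def sum_distrib_left Suc_diff_le mult_ac)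
  finally show ?thesis .
qed

lemma poly_hermite_poly:
  assumes "z \<noteq> 0" "(2::'a) \<noteq> 0"
  shows "poly (hermite_poly n) ((z + inverse z) / 2) = rogers_szego z (inverse z) n / 2 ^ n"
proof (induction n rule: hermite_poly.induct)
  case 1
  then show ?case by (simp add: rogers_szego_def)
next
  case 2
  then show ?case by (simp add: rogers_szego_def)
next
  case (3 n)
  have "x / 2 * (r / (2 * h)) - e / 4 * (s / h) = (x * r - e * s) / (2 * (2 * h))"
    if "h \<noteq> 0" for x r e s h :: 'a
    by (simp add: diff_divide_distrib mult.assoc)
  from this[of "2 ^ n" "z + inverse z" "rogers_szego z (inverse z) (Suc n)" "1 - q ^ Suc n"
      "rogers_szego z (inverse z) n"]
  show ?case
    using assms by (simp add: 3 rogers_szego_rec del: power_Suc) simp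
qed

lemma aw_basis_times_x:
  assumes "a \<noteq> 0" "(2::'a) \<noteq> 0"
  shows "x * poly (aw_basis a j) x
    = ((1 + (a * q ^ j)\<^sup>2) * poly (aw_basis a j) x - poly (aw_basis a (Suc j)) x) / (2 * a * q ^ j)"
  using assms q_nz by (simp add: aw_basis_def field_simps)

lemma big_hermite_coeff_rec:
  assumes a: "a \<noteq> 0" and two: "(2::'a) \<noteq> 0"
  defines "C \<equiv> aw_coeff a 0 0 0"
  shows "C k j * (1 + (a * q ^ j)\<^sup>2) / (2 * a * q ^ j)
      - (if j = 0 then 0 else C k (j - 1) / (2 * a * q ^ (j - 1)))
    = C (Suc k) j + a * q ^ k / 2 * C k j + (1 - q ^ k) / 4 * C (k - 1) j"
proof -
  \<comment> \<open>B is the common prefactor of all coefficients that occur. Once it is taken out,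
    an identity between Gaussian binomials remains.\<close>
  define B where "B = (\<Prod>i<j. - (q ^ Suc i)) / ((2 * a) ^ Suc k * q ^ (Suc k * j))"
  have C1: "C k j = 2 * a * q ^ j * qb k j * B"
    using a two q_nz by (simp add: C_def aw_coeff_def B_def power_add)
  have C2: "C (Suc k) j = qb (Suc k) j * B"
    by (simp add: C_def aw_coeff_def B_def power_add)
  have C3: "(1 - q ^ k) / 4 * C (k - 1) j = a\<^sup>2 * (q ^ j)\<^sup>2 * ((1 - q ^ k) * qb (k - 1) j) * B"
  proof (cases k)
    case (Suc k')
    have four: "(4::'a) \<noteq> 0"
      using two by (metis mult_2 numeral_Bit0 no_zero_divisors)
    have "C k' j = 4 * (a\<^sup>2 * (q ^ j)\<^sup>2 * qb k' j * B)"
    proof -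
      have "C k' j = (2 * a)\<^sup>2 * (q ^ j)\<^sup>2 * qb k' j * B"
        using a two q_nz four
        by (simp add: C_def aw_coeff_def B_def power_add Suc power2_eq_square del: power_mult_distrib)
      then show ?thesis
        by (simp add: power_mult_distrib)
    qed
    then show ?thesis
      using four by (simp add: Suc mult_ac)
  qed simp
  have C4: "(if j = 0 then 0 else C k (j - 1) / (2 * a * q ^ (j - 1)))
      = (qb k j - qb (Suc k) j) * B"
  proof (cases j)
    case (Suc j')
    have "qb k j - qb (Suc k) j = - (q ^ (k - j') * qb k j')"
      unfolding Suc qb_Suc_Suc' by simp
    moreover have "C k j' / (2 * a * q ^ j') = - (q ^ (k - j') * qb k j') * B"
    proof (cases "j' \<le> k")
      case True
      then have "q ^ k = q ^ (k - j') * q ^ j'"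
        by (simp flip: power_add)
      then show ?thesis
        using a two q_nz by (simp add: C_def aw_coeff_def B_def power_add Suc mult_ac)
    next
      case False
      then show ?thesis by (simp add: C_def aw_coeff_eq_0 qbinom_eq_0)
    qed
    ultimately show ?thesis by (simp add: Suc)
  qed simp
  have *: "q ^ j * ((1 - q ^ k) * qb (k - 1) j) = (q ^ j - q ^ k) * qb k j"
  proof (cases "j \<le> k")
    case True
    have eq: "(1 - q ^ k) * qb (k - 1) j = (1 - q ^ (k - j)) * qb k j"
      using qb_absorb'[of "k - 1" j] True by (cases k) auto
    have "q ^ k = q ^ (k - j) * q ^ j"
      using True by (simp flip: power_add)
    then show ?thesis
      unfolding eq by (simp add: algebra_simps)
  next
    case False
    then show ?thesis by (simp add: qbinom_eq_0)
  qed
  have "C k j * (1 + (a * q ^ j)\<^sup>2) / (2 * a * q ^ j) = qb k j * (1 + (a * q ^ j)\<^sup>2) * B"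
    unfolding C1 using a two q_nz by simp
  also have "\<dots> - (qb k j - qb (Suc k) j) * B
      = qb (Suc k) j * B + a * q ^ k / 2 * C k j
        + a\<^sup>2 * q ^ j * (q ^ j * ((1 - q ^ k) * qb (k - 1) j)) * B"
    unfolding * C1 using two by (simp add: power2_eq_square algebra_simps)
  finally show ?thesis
    unfolding C2 C3 C4 by (simp add: power2_eq_square mult_ac)
qed

text \<open>This is the three-term recurrence of the monic continuous big q-Hermite polynomials, the
  case b = c = d = 0. For k = 0 the truncated \<open>k - 1\<close> is multiplied by 1 - q^0 =
  0.\<close>

lemma big_hermite_rec:
  assumes a: "a \<noteq> 0" and two: "(2::'a) \<noteq> 0"
  shows "x * poly (aw_poly a 0 0 0 k) x
    = poly (aw_poly a 0 0 0 (Suc k)) x + a * q ^ k / 2 * poly (aw_poly a 0 0 0 k) x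
      + (1 - q ^ k) / 4 * poly (aw_poly a 0 0 0 (k - 1)) x"
proof -
  define C where "C = aw_coeff a 0 0 0"
  define p where "p j = poly (aw_basis a j) x" for j
  have "x * poly (aw_poly a 0 0 0 k) x = (\<Sum>j\<le>k. C k j * (x * p j))"
    by (simp add: poly_aw_poly[OF order_refl] C_def p_def sum_distrib_left mult_ac)
  also have "\<dots> = (\<Sum>j\<le>k. C k j * (1 + (a * q ^ j)\<^sup>2) / (2 * a * q ^ j) * p j)
      - (\<Sum>j\<le>k. C k j / (2 * a * q ^ j) * p (Suc j))"
    unfolding p_def aw_basis_times_x[OF a two] sum_subtractf[symmetric]
    by (intro sum.cong refl) (simp add: diff_divide_distrib algebra_simps)
  also have "(\<Sum>j\<le>k. C k j * (1 + (a * q ^ j)\<^sup>2) / (2 * a * q ^ j) * p j)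
      = (\<Sum>j\<le>Suc k. C k j * (1 + (a * q ^ j)\<^sup>2) / (2 * a * q ^ j) * p j)"
    by (simp add: C_def aw_coeff_eq_0)
  also have "(\<Sum>j\<le>k. C k j / (2 * a * q ^ j) * p (Suc j))
      = (\<Sum>j\<le>Suc k. (if j = 0 then 0 else C k (j - 1) / (2 * a * q ^ (j - 1))) * p j)"
    by (simp add: sum.atMost_Suc_shift del: sum.atMost_Suc)
  finally have "x * poly (aw_poly a 0 0 0 k) x
      = (\<Sum>j\<le>Suc k. (C (Suc k) j + a * q ^ k / 2 * C k j + (1 - q ^ k) / 4 * C (k - 1) j) * p j)"
    using big_hermite_coeff_rec[OF a two]
    unfolding C_def sum_subtractf[symmetric] left_diff_distrib[symmetric] by simp
  then show ?thesis
    unfolding ring_distribs sum.distrib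
    by (simp only: poly_aw_poly[of k "Suc k"] poly_aw_poly[of "Suc k" "Suc k"]
        poly_aw_poly[of "k - 1" "Suc k"] C_def p_def sum_distrib_left mult.assoc)
qed

text \<open>
  If the east steps of one level of the graph have weights \<open>u i * q ^ j\<close>, then the paths that cross
  this level from column \<open>l\<close> at its top to column \<open>n\<close> at its bottom have the total weight
  \<open>(\<Prod>i=l..<n. u i) * qb n l\<close>, because the exponents \<open>j\<close> form a partition in an
  \<open>(n - l) \<times> l\<close> box.
\<close>

definition level_op :: "(nat \<Rightarrow> 'a) \<Rightarrow> (nat \<Rightarrow> 'a) \<Rightarrow> nat \<Rightarrow> 'a" where
  "level_op u v n = (\<Sum>l\<le>n. (\<Prod>i=l..<n. u i) * qb n l * v l)"

lemma level_op_cong: "(\<And>l. l \<le> n \<Longrightarrow> v l = v' l) \<Longrightarrow> level_op u v n = level_op u v' n"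
  unfolding level_op_def by (intro sum.cong) auto

lemma level_op_sum:
  "level_op u (\<lambda>n. \<Sum>k\<in>K. r n k * p k) = (\<lambda>n. \<Sum>k\<in>K. level_op u (\<lambda>n. r n k) n * p k)"
  unfolding level_op_def fun_eq_iff sum_distrib_left sum_distrib_right
  by (intro allI, subst sum.swap) (simp only: mult.assoc)

lemma level_op_eq_0: "(\<And>l. l \<le> n \<Longrightarrow> v l = 0) \<Longrightarrow> level_op u v n = 0"
  unfolding level_op_def by (intro sum.neutral) auto

text \<open>Trinomial revision pulls the factor \<open>qb n k\<close> out of the sum over the
  intermediate column l. What is left is the q-binomial theorem at x q^k.\<close>

lemma level_op_combine:
  "level_op u (level_op (\<lambda>i. - x * q ^ i * u i) v) = level_op (\<lambda>i. (1 - x * q ^ i) * u i) v"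
proof
  fix n
  have "(\<Sum>l\<le>n. \<Sum>k\<le>l. (\<Prod>i=l..<n. u i) * qb n l * ((\<Prod>i=k..<l. - x * q ^ i * u i) * qb l k * v k))
      = (\<Sum>k\<le>n. \<Sum>l=k..n. (\<Prod>i=l..<n. u i) * qb n l * ((\<Prod>i=k..<l. - x * q ^ i * u i) * qb l k * v k))"
    unfolding sum.Sigma[OF finite_atMost ballI[OF finite_atMost]]
      sum.Sigma[OF finite_atMost ballI[OF finite_atLeastAtMost]]
    by (rule sum.reindex_bij_witness[of _ prod.swap prod.swap]) auto
  also have "\<dots> = (\<Sum>k\<le>n. (\<Prod>i=k..<n. (1 - x * q ^ i) * u i) * qb n k * v k)"
  proof (intro sum.cong refl)
    fix k assume "k \<in> {..n}"
    then have k: "k \<le> n" by simp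
    define t where "t r = qb (n - k) r * (\<Prod>i<r. - (x * q ^ k) * q ^ i)" for r
    have "(\<Sum>l=k..n. (\<Prod>i=l..<n. u i) * qb n l * ((\<Prod>i=k..<l. - x * q ^ i * u i) * qb l k * v k))
        = (\<Sum>l=k..n. (\<Prod>i=k..<n. u i) * qb n k * v k * t (l - k))"
    proof (intro sum.cong refl)
      fix l assume "l \<in> {k..n}"
      then have l: "k \<le> l" "l \<le> n" by auto
      have "(\<Prod>i=k..<l. - x * q ^ i) = (\<Prod>i<l - k. - (x * q ^ k) * q ^ i)"
        by (rule prod.reindex_bij_witness[of _ "\<lambda>i. i + k" "\<lambda>i. i - k"])
           (auto simp: mult.assoc simp flip: power_add)
      moreover have "(\<Prod>i=k..<n. u i) = (\<Prod>i=k..<l. u i) * (\<Prod>i=l..<n. u i)"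
        using l by (simp add: prod.atLeastLessThan_concat)
      ultimately show "(\<Prod>i=l..<n. u i) * qb n l * ((\<Prod>i=k..<l. - x * q ^ i * u i) * qb l k * v k)
          = (\<Prod>i=k..<n. u i) * qb n k * v k * t (l - k)"
        using qb_trinomial[OF l] unfolding prod.distrib t_def by (simp add: mult_ac)
    qed
    also have "\<dots> = (\<Prod>i=k..<n. u i) * qb n k * v k * (\<Sum>r\<le>n - k. t r)"
      unfolding sum_distrib_left using k
      by (intro sum.reindex_bij_witness[of _ "\<lambda>r. r + k" "\<lambda>l. l - k"]) auto
    also have "(\<Sum>r\<le>n - k. t r) = (\<Prod>i<n - k. 1 - x * q ^ k * q ^ i)"
      unfolding t_def by (rule qb_theorem)
    also have "\<dots> = (\<Prod>i=k..<n. 1 - x * q ^ i)"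
      by (rule prod.reindex_bij_witness[of _ "\<lambda>i. i - k" "\<lambda>i. i + k"])
         (auto simp: power_add mult_ac)
    finally show "(\<Sum>l=k..n. (\<Prod>i=l..<n. u i) * qb n l
          * ((\<Prod>i=k..<l. - x * q ^ i * u i) * qb l k * v k))
        = (\<Prod>i=k..<n. (1 - x * q ^ i) * u i) * qb n k * v k"
      by (simp only: prod.distrib mult_ac)
  qed
  finally show "level_op u (level_op (\<lambda>i. - x * q ^ i * u i) v) n
      = level_op (\<lambda>i. (1 - x * q ^ i) * u i) v n"
    by (simp only: level_op_def sum_distrib_left)
qed

text \<open>Because the coefficients divide by powers of a, \<open>aw_poly_connection\<close> cannot
  start from a = 0. Instead the right-hand side is shown to obey the recurrence that defines
  \<open>hermite_poly\<close>.\<close>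

lemma hermite_connection:
  assumes a: "a \<noteq> 0" and two: "(2::'a) \<noteq> 0"
  shows "poly (hermite_poly n) x = level_op (\<lambda>i. a / 2) (\<lambda>n. poly (aw_poly a 0 0 0 n) x) n"
proof -
  define Q where "Q k = poly (aw_poly a 0 0 0 k) x" for k
  define h where "h n = (\<Sum>k\<le>n. qb n k * ((a / 2) ^ (n - k) * Q k))" for n
  \<comment> \<open>For n = 0 the term with the truncated \<open>n - 1\<close> vanishes, since 1 -
    q^0 = 0.\<close>
  have rec: "h (Suc n) = x * h n - (1 - q ^ n) / 4 * h (n - 1)" for n
  proof -
    have "x * h n = (\<Sum>k\<le>n. qb n k * ((a / 2) ^ (n - k)
        * (Q (Suc k) + a * q ^ k / 2 * Q k + (1 - q ^ k) / 4 * Q (k - 1))))"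
      unfolding h_def sum_distrib_left
      using big_hermite_rec[OF a two, of x]
      by (intro sum.cong refl) (simp only: mult.left_commute[of x] Q_def)
    \<comment> \<open>The first two terms of the recurrence for Q recombine by the defining Pascal
      rule to \<open>h (Suc n)\<close>; the third becomes a multiple of \<open>h (n - 1)\<close> by
      absorption.\<close>
    also have "\<dots> = (\<Sum>k\<le>n. qb n k * ((a / 2) ^ (n - k) * Q (Suc k) + q ^ k * ((a / 2) ^ (Suc n - k) * Q k)))
        + (\<Sum>k\<le>n. (1 - q ^ k) / 4 * qb n k * ((a / 2) ^ (n - k) * Q (k - 1)))"
      unfolding sum.distrib[symmetric]
      by (intro sum.cong refl) (auto simp: Suc_diff_le algebra_simps)
    also have "(\<Sum>k\<le>n. qb n k * ((a / 2) ^ (n - k) * Q (Suc k) + q ^ k * ((a / 2) ^ (Suc n - k) * Q k)))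
        = h (Suc n)"
    proof -
      have "h (Suc n) = (a / 2) ^ Suc n * Q 0
          + (\<Sum>k\<le>n. (qb n k + q ^ Suc k * qb n (Suc k)) * ((a / 2) ^ (n - k) * Q (Suc k)))"
        unfolding h_def by (simp add: sum.atMost_Suc_shift del: sum.atMost_Suc)
      also have "\<dots> = (\<Sum>k\<le>n. qb n k * ((a / 2) ^ (n - k) * Q (Suc k)))
          + (\<Sum>k\<le>Suc n. qb n k * (q ^ k * ((a / 2) ^ (Suc n - k) * Q k)))"
        by (simp add: sum.atMost_Suc_shift sum.distrib ring_distribs mult_ac del: sum.atMost_Suc)
      also have "(\<Sum>k\<le>Suc n. qb n k * (q ^ k * ((a / 2) ^ (Suc n - k) * Q k)))
          = (\<Sum>k\<le>n. qb n k * (q ^ k * ((a / 2) ^ (Suc n - k) * Q k)))"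
        by (simp add: qbinom_eq_0)
      finally show ?thesis
        by (simp only: ring_distribs sum.distrib)
    qed
    also have "(\<Sum>k\<le>n. (1 - q ^ k) / 4 * qb n k * ((a / 2) ^ (n - k) * Q (k - 1)))
        = (1 - q ^ n) / 4 * h (n - 1)"
    proof (cases n)
      case (Suc m)
      have "(\<Sum>k\<le>n. (1 - q ^ k) / 4 * qb n k * ((a / 2) ^ (n - k) * Q (k - 1)))
          = (\<Sum>k\<le>m. ((1 - q ^ Suc k) * qb (Suc m) (Suc k)) / 4 * ((a / 2) ^ (m - k) * Q k))"
        by (simp add: Suc sum.atMost_Suc_shift del: sum.atMost_Suc qbinom.simps(3) power_Suc)
      also have "\<dots> = (1 - q ^ n) / 4 * h (n - 1)"
        unfolding qb_absorb h_def sum_distrib_left by (simp add: Suc mult_ac)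
      finally show ?thesis .
    qed simp
    finally show ?thesis by simp
  qed
  have "poly (hermite_poly n) x = h n"
  proof (induction n rule: hermite_poly.induct)
    case 1
    show ?case
      by (simp add: h_def Q_def aw_poly_def aw_coeff_def aw_basis_def)
  next
    case 2
    have "h 0 = 1"
      by (simp add: h_def Q_def aw_poly_def aw_coeff_def aw_basis_def)
    then show ?case
      using rec[of 0] by simp
  next
    case (3 n)
    then show ?case
      using rec[of "Suc n"] by simp
  qed
  then show ?thesis
    by (simp add: h_def level_op_def Q_def mult_ac)
qed

text \<open>The parameters \<open>a, b, c, d\<close> are switched on one after the other.\<close>

definition moment_col :: "'a \<Rightarrow> 'a \<Rightarrow> 'a \<Rightarrow> 'a \<Rightarrow> nat \<Rightarrow> nat \<Rightarrow> 'a" where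
  "moment_col a b c d k =
     level_op (\<lambda>i. a / 2) (level_op (\<lambda>i. b / 2) (level_op (\<lambda>i. c / 2)
       (level_op (\<lambda>i. - (a * b) * q ^ i * (c / 2)) (\<lambda>n. connection_coeff a b c d n k))))"

lemma moment_col_eq_0: "n < k \<Longrightarrow> moment_col a b c d k n = 0"
  unfolding moment_col_def by (intro level_op_eq_0) (simp add: connection_coeff_eq_0)

end

text \<open>Comparing top coefficients shows that the P k are linearly independent, so the definite
  description has a unique solution.\<close>

lemma mixed_moment_eqI:
  fixes P Q :: "nat \<Rightarrow> 'a::field poly"
  assumes deg: "\<And>k. degree (P k) \<le> k" and coeff: "\<And>k. coeff (P k) k \<noteq> 0"
    and Q: "Q n = (\<Sum>k\<le>n. smult (\<sigma> k) (P k))" and \<sigma>: "\<And>k. n < k \<Longrightarrow> \<sigma> k = 0"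
  shows "mixed_moment P Q n = \<sigma>"
  unfolding mixed_moment_def
proof (rule the_equality)
  show "Q n = (\<Sum>k\<le>n. smult (\<sigma> k) (P k)) \<and> (\<forall>k>n. \<sigma> k = 0)"
    using Q \<sigma> by blast
next
  fix \<tau> assume \<tau>: "Q n = (\<Sum>k\<le>n. smult (\<tau> k) (P k)) \<and> (\<forall>k>n. \<tau> k = 0)"
  have indep: "\<forall>k\<le>m. c k = 0" if "(\<Sum>k\<le>m. smult (c k) (P k)) = 0" for m c
    using that
  proof (induction m)
    case 0
    then show ?case using coeff[of 0] by auto
  next
    case (Suc m)
    have "coeff (P k) (Suc m) = 0" if "k \<le> m" for k
      using deg[of k] that by (intro coeff_eq_0) auto
    then have "coeff (\<Sum>k\<le>Suc m. smult (c k) (P k)) (Suc m) = c (Suc m) * coeff (P (Suc m)) (Suc m)"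
      by (simp add: coeff_sum)
    then have "c (Suc m) = 0"
      unfolding Suc.prems using coeff[of "Suc m"] by simp
    then show ?case
      using Suc by (auto simp: le_Suc_eq)
  qed
  have "(\<Sum>k\<le>n. smult (\<tau> k - \<sigma> k) (P k)) = 0"
    using Q \<tau> by (simp add: smult_diff_left sum_subtractf)
  then have "\<forall>k\<le>n. \<tau> k - \<sigma> k = 0"
    by (rule indep)
  then show "\<tau> = \<sigma>"
    using \<sigma> \<tau> by (intro ext) (metis eq_iff_diff_eq_0 linorder_not_le)
qed

lemma qpoch_split:
  "k \<le> n \<Longrightarrow> qpoch x q n = qpoch x q k * (\<Prod>i=k..<n. 1 - x * q ^ i)"
  unfolding qpoch_def lessThan_atLeast0 by (simp add: prod.atLeastLessThan_concat)

section \<open>Agreement with the hypergeometric definitions and expansion of the q-Hermite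
  polynomials\<close>

locale generic_q_top = generic_q q for q :: "'a::{field_char_0, t2_space}"
begin

lemma two_neq_zero: "(2::'a) \<noteq> 0"
  by simp

text \<open>All terms beyond n are zero, so the infinite series is a finite sum and raises no
  question of convergence.\<close>

lemma qhyper_terminating:
  assumes "\<And>k. qpochs (q powi (- int n) # \<alpha>s) q k / qpochs (q # \<beta>s) q k
        * ((-1) ^ k * q ^ (k choose 2)) powi (1 + int (length \<beta>s) - int (length (q powi (- int n) # \<alpha>s)))
        * z ^ k = qb n k * t k"
  shows "qhyper (q powi (- int n) # \<alpha>s) \<beta>s q z = (\<Sum>k\<le>n. qb n k * t k)"
  unfolding qhyper_def assms by (intro suminf_finite) (auto simp: qbinom_eq_0)

lemma askey_wilson_eq_aw_poly:
  assumes a: "a \<noteq> 0" and ab: "\<And>m. a * b * q ^ m \<noteq> 1" and ac: "\<And>m. a * c * q ^ m \<noteq> 1"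
    and ad: "\<And>m. a * d * q ^ m \<noteq> 1" and abcd: "\<And>m. a * b * c * d * q ^ m \<noteq> 1"
  shows "askey_wilson a b c d q n = aw_poly a b c d n"
  unfolding askey_wilson_def
proof (rule cos_poly_eqI)
  fix z :: 'a assume z: "z \<noteq> 0"
  define D where "D = a * b * c * d * q powi (int n - 1)"
  define t where "t k = (\<Prod>i<k. - (q ^ i)) / q ^ (n * k)
     * (qpoch D q k * (qpoch (a * z) q k * qpoch (a * inverse z) q k)
         / (qpoch (a * b) q k * qpoch (a * c) q k * qpoch (a * d) q k)) * q ^ k" for k
  have hyper: "qhyper [q powi (- int n), D, a * z, a * inverse z] [a * b, a * c, a * d] q q
      = (\<Sum>k\<le>n. qb n k * t k)"
  proof (rule qhyper_terminating)
    fix k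
    show "qpochs [q powi - int n, D, a * z, a * inverse z] q k / qpochs [q, a * b, a * c, a * d] q k
        * ((-1) ^ k * q ^ (k choose 2)) powi (1 + int (length [a * b, a * c, a * d])
            - int (length [q powi - int n, D, a * z, a * inverse z])) * q ^ k = qb n k * t k"
    proof -
      have "qpochs [q powi - int n, D, a * z, a * inverse z] q k / qpochs [q, a * b, a * c, a * d] q k
          = (qpoch (q powi - int n) q k / qpoch q q k)
            * (qpoch D q k * (qpoch (a * z) q k * qpoch (a * inverse z) q k)
               / (qpoch (a * b) q k * qpoch (a * c) q k * qpoch (a * d) q k))"
        by (simp add: qpochs_def mult_ac)
      then show ?thesis
        unfolding qpoch_neg_power by (simp add: t_def)
    qed
  qed
  \<comment> \<open>An index i < n forces n > 0, so the integer power with exponent n - 1 is an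
    ordinary one. For n = 0 the exponent is -1, but then all products involving D are empty.\<close>
  have Dq: "D * q ^ i = a * b * c * d * q ^ (n - 1 + i)" if "i < n" for i
  proof -
    have "q powi (int n - 1) = q ^ (n - 1)"
      using that by (simp add: power_int_def nat_diff_distrib)
    then show ?thesis
      by (simp add: D_def power_add mult.assoc)
  qed
  show "poly (aw_poly a b c d n) ((z + inverse z) / 2) =
      qpochs [a * b, a * c, a * d] q n / (2 ^ n * a ^ n * qpoch (a * b * c * d * q powi (int n - 1)) q n)
      * qhyper [q powi (- int n), a * b * c * d * q powi (int n - 1), a * z, a * inverse z]
          [a * b, a * c, a * d] q q"
    unfolding D_def[symmetric] hyper poly_aw_poly[OF order_refl] sum_distrib_left
  proof (intro sum.cong refl)
    fix k assume "k \<in> {..n}"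
    then have k: "k \<le> n" by simp
    have nz: "qpoch (a * b) q k \<noteq> 0" "qpoch (a * c) q k \<noteq> 0" "qpoch (a * d) q k \<noteq> 0"
      using ab ac ad by (simp_all add: qpoch_def)
    have nzD: "qpoch D q k \<noteq> 0"
      using abcd k by (simp add: qpoch_def Dq)
    have D: "qpoch D q n = qpoch D q k * (\<Prod>i=k..<n. 1 - a * b * c * d * q ^ (n - 1 + i))"
      unfolding qpoch_split[OF k, of D] by (simp add: Dq)
    have "(\<Prod>i<k. - (q ^ Suc i)) = (\<Prod>i<k. q * - (q ^ i))"
      by simp
    also have "\<dots> = q ^ k * (\<Prod>i<k. - (q ^ i))"
      by (simp only: prod.distrib prod_constant card_lessThan)
    finally have P: "(\<Prod>i<k. - (q ^ Suc i)) = q ^ k * (\<Prod>i<k. - (q ^ i))" .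
    have nzE: "(\<Prod>i=k..<n. 1 - a * b * c * d * q ^ (n - 1 + i)) \<noteq> 0"
      using abcd by simp
    show "aw_coeff a b c d n k * poly (aw_basis a k) ((z + inverse z) / 2)
      = qpochs [a * b, a * c, a * d] q n / (2 ^ n * a ^ n * qpoch D q n) * (qb n k * t k)"
      unfolding aw_coeff_def t_def poly_aw_basis[OF z two_neq_zero] P D
        prod_dividef prod.distrib
      using nz nzD nzE q_nz a
      by (simp add: qpochs_def qpoch_split[OF k, of "a * b"] qpoch_split[OF k, of "a * c"]
          qpoch_split[OF k, of "a * d"] power_mult_distrib mult_ac)
  qed
qed

lemma q_hermite_eq_hermite_poly: "q_hermite q n = hermite_poly n"
  unfolding q_hermite_def
proof (rule cos_poly_eqI)
  fix z :: 'a assume z: "z \<noteq> 0"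
  have "qhyper [q powi (- int n), 0] [] q (q ^ n * z powi (- 2)) = (\<Sum>k\<le>n. qb n k * (z powi (-2)) ^ k)"
  proof (rule qhyper_terminating)
    fix k
    \<comment> \<open>The exponent in \<open>qhyper\<close> is 1 + 0 - 2 = -1, so s cancels against
      the same factor from \<open>qpoch_neg_power\<close>; the power q^(nk) cancels against the
      argument of the series.\<close>
    define s where "s = (-1) ^ k * q ^ (k choose 2)"
    have s: "(\<Prod>i<k. - (q ^ i)) = s"
      unfolding s_def
    proof (induction k)
      case (Suc k)
      then show ?case
        by (simp add: numeral_2_eq_2 power_add)
    qed (simp add: numeral_2_eq_2)
    have "s \<noteq> 0"
      using q_nz by (simp add: s_def)
    have "qpochs [q powi - int n, 0] q k / qpochs [q] q k = qb n k * s / q ^ (n * k)"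
      using qpoch_neg_power[of n k] by (simp add: qpochs_def s) (simp add: qpoch_def)
    then show "qpochs [q powi - int n, 0] q k / qpochs [q] q k
        * ((-1) ^ k * q ^ (k choose 2)) powi (1 + int (length []) - int (length [q powi - int n, 0]))
        * (q ^ n * z powi - 2) ^ k = qb n k * (z powi (-2)) ^ k"
      unfolding s_def[symmetric] using \<open>s \<noteq> 0\<close> q_nz
      by (simp add: power_mult_distrib power_int_minus flip: power_mult)
  qed
  then show "poly (hermite_poly n) ((z + inverse z) / 2)
      = z ^ n / 2 ^ n * qhyper [q powi - int n, 0] [] q (q ^ n * z powi - 2)"
    unfolding poly_hermite_poly[OF z two_neq_zero] rogers_szego_def
  proof (simp add: sum_distrib_left sum_divide_distrib, intro sum.cong refl)
    fix k assume "k \<in> {..n}"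
    then have "z ^ n = z ^ (n - k) * z ^ k"
      by (simp flip: power_add)
    then show "qb n k * (z ^ (n - k) * inverse z ^ k) / 2 ^ n
        = z ^ n * (qb n k * (z powi - 2) ^ k) / 2 ^ n"
      using z by (simp add: power_int_minus power2_eq_square power_mult_distrib power_inverse field_simps)
  qed
qed

text \<open>With one of the three fixed parameters equal to 0, the denominators and two of the three
  numerator factors of \<open>connection_coeff\<close> become 1. The connection matrix is then a
  single level.\<close>

lemma aw_poly_level:
  assumes "a \<noteq> 0"
  shows "poly (aw_poly a b 0 0 n) x
    = level_op (\<lambda>i. (1 - a * b * q ^ i) * (c / 2)) (\<lambda>n. poly (aw_poly a b c 0 n) x) n"
proof -
  have "poly (aw_poly a b 0 0 n) x
      = (\<Sum>k\<le>n. connection_coeff a b 0 c n k * poly (aw_poly a b 0 c k) x)"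
    using assms by (intro aw_poly_connection) auto
  then show ?thesis
    unfolding level_op_def connection_coeff_def aw_poly_commute(1)[of a b c] by (simp add: mult_ac)
qed

lemma hermite_expansion:
  assumes a: "a \<noteq> 0" and D: "\<And>m. a * b * c * d * q ^ m \<noteq> 1"
  shows "hermite_poly n = (\<Sum>k\<le>n. smult (moment_col a b c d k n) (aw_poly a b c d k))"
proof -
  have "poly (hermite_poly n) x = poly (\<Sum>k\<le>n. smult (moment_col a b c d k n) (aw_poly a b c d k)) x" for x
  proof -
    have b: "poly (aw_poly a 0 0 0 l) x = level_op (\<lambda>i. b / 2) (\<lambda>n. poly (aw_poly a b 0 0 n) x) l" for l
      using aw_poly_level[OF a, of 0 l x b] aw_poly_commute(1)[of a 0 b] aw_poly_commute(2)[of a b] by simp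
    have c: "poly (aw_poly a b 0 0 l) x = level_op (\<lambda>i. c / 2)
        (level_op (\<lambda>i. - (a * b) * q ^ i * (c / 2)) (\<lambda>n. poly (aw_poly a b c 0 n) x)) l" for l
      unfolding level_op_combine by (rule aw_poly_level[OF a])
    \<comment> \<open>The range of k must not depend on l for \<open>level_op_sum\<close> to apply;
      the added terms are 0.\<close>
    have d: "poly (aw_poly a b c 0 l) x
        = (\<Sum>k\<le>n. connection_coeff a b c d l k * poly (aw_poly a b c d k) x)" if "l \<le> n" for l
      unfolding aw_poly_connection[OF a two_neq_zero D] using that
      by (intro sum.mono_neutral_left) (auto simp: connection_coeff_eq_0)
    have "poly (hermite_poly n) x = level_op (\<lambda>i. a / 2) (level_op (\<lambda>i. b / 2) (level_op (\<lambda>i. c / 2)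
        (level_op (\<lambda>i. - (a * b) * q ^ i * (c / 2)) (\<lambda>n. poly (aw_poly a b c 0 n) x)))) n"
      unfolding hermite_connection[OF a two_neq_zero] b c ..
    also have "\<dots> = level_op (\<lambda>i. a / 2) (level_op (\<lambda>i. b / 2) (level_op (\<lambda>i. c / 2)
        (level_op (\<lambda>i. - (a * b) * q ^ i * (c / 2))
          (\<lambda>l. \<Sum>k\<le>n. connection_coeff a b c d l k * poly (aw_poly a b c d k) x)))) n"
      by (intro level_op_cong d) simp
    also have "\<dots> = (\<Sum>k\<le>n. moment_col a b c d k n * poly (aw_poly a b c d k) x)"
      unfolding level_op_sum moment_col_def ..
    finally show ?thesis
      by (simp add: poly_sum)
  qed
  then have "poly (hermite_poly n) = poly (\<Sum>k\<le>n. smult (moment_col a b c d k n) (aw_poly a b c d k))"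
    by (rule ext)
  then show ?thesis
    by (simp only: poly_eq_poly_eq_iff)
qed

lemma mixed_moment_eq_moment_col:
  assumes a: "a \<noteq> 0" and ab: "\<And>m. a * b * q ^ m \<noteq> 1" and ac: "\<And>m. a * c * q ^ m \<noteq> 1"
    and ad: "\<And>m. a * d * q ^ m \<noteq> 1" and abcd: "\<And>m. a * b * c * d * q ^ m \<noteq> 1"
  shows "mixed_moment (askey_wilson a b c d q) (q_hermite q) n = (\<lambda>k. moment_col a b c d k n)"
proof (rule mixed_moment_eqI)
  have P: "askey_wilson a b c d q k = aw_poly a b c d k" for k
    using assms by (rule askey_wilson_eq_aw_poly)
  show "degree (askey_wilson a b c d q k) \<le> k" "coeff (askey_wilson a b c d q k) k \<noteq> 0" for k
    unfolding P using degree_aw_poly_le[OF a two_neq_zero] coeff_aw_poly_nz[OF a two_neq_zero] by auto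
  show "q_hermite q n = (\<Sum>k\<le>n. smult (moment_col a b c d k n) (askey_wilson a b c d q k))"
    unfolding P q_hermite_eq_hermite_poly
    using a abcd by (intro hermite_expansion) auto
  show "moment_col a b c d k n = 0" if "n < k" for k
    using that by (rule moment_col_eq_0)
qed

end

section \<open>Paths in the lecture hall graph\<close>

text \<open>Numbering the vertices of a column from the bottom by c = t (i + 1) + j makes the
  identification of j = i + 1 with the next level automatic, and a south step simply lowers c by
  1.\<close>

definition col_vertex :: "nat \<Rightarrow> nat \<Rightarrow> vertex" where
  "col_vertex i c = (i, real c / (real i + 1))"

lemma lh_vertex_eq: "lh_vertex t i j = col_vertex i (t * Suc i + j)"
  by (simp add: lh_vertex_def col_vertex_def field_simps)

lemma fst_col_vertex [simp]: "fst (col_vertex i c) = i"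
  by (simp add: col_vertex_def)

lemma col_vertex_eq_iff [simp]: "col_vertex i c = col_vertex i' c' \<longleftrightarrow> i = i' \<and> c = c'"
  by (auto simp: col_vertex_def divide_cancel_right)

lemma lh_index_eq_iff:
  assumes "j \<le> i" "j' \<le> i"
  shows "t * Suc i + j = t' * Suc i + j' \<longleftrightarrow> t = t' \<and> j = j'"
proof
  assume eq: "t * Suc i + j = t' * Suc i + j'"
  have "(t * Suc i + j) div Suc i = t" "(t' * Suc i + j') div Suc i = t'"
    using assms by (simp_all add: div_mult_self3 del: mult_Suc_right)
  then have "t = t'" using eq by metis
  then show "t = t' \<and> j = j'" using eq by simp
qed auto

lemma mem_south_steps:
  "(y, x) \<in> south_steps \<longleftrightarrow> (\<exists>i c. y = col_vertex i (Suc c) \<and> x = col_vertex i c)"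
proof
  assume "\<exists>i c. y = col_vertex i (Suc c) \<and> x = col_vertex i c"
  then obtain i c where *: "y = col_vertex i (Suc c)" "x = col_vertex i c" by blast
  have "c = c div Suc i * Suc i + c mod Suc i" "c mod Suc i \<le> i"
    using mod_less_divisor[of "Suc i" c] by (simp_all only: div_mult_mod_eq less_Suc_eq_le zero_less_Suc)
  then show "(y, x) \<in> south_steps"
    unfolding south_steps_def lh_vertex_eq * by (metis (mono_tags, lifting) add_Suc_right mem_Collect_eq)
qed (auto simp: south_steps_def lh_vertex_eq)

lemma mem_east_steps:
  "(y, x) \<in> east_steps \<longleftrightarrow>
     (\<exists>t i j. j \<le> i \<and> y = col_vertex i (t * Suc i + j) \<and> x = col_vertex (Suc i) (t * Suc (Suc i) + j))"
  by (auto simp: east_steps_def lh_vertex_eq simp del: mult_Suc_right)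

lemma mem_east_indices:
  "(t, i, j) \<in> east_indices v \<longleftrightarrow> j \<le> i \<and>
     (\<exists>m. v (Suc m) = col_vertex i (t * Suc i + j) \<and> v m = col_vertex (Suc i) (t * Suc (Suc i) + j))"
  by (auto simp: east_indices_def lh_vertex_eq simp del: mult_Suc_right)

text \<open>The end point is arbitrary here, so that removing the last step of a path stays within
  the family.\<close>

definition paths_to :: "nat \<Rightarrow> vertex \<Rightarrow> (nat \<Rightarrow> vertex) set" where
  "paths_to k x =
     {v. v 0 = x
       \<and> (\<forall>m. (v (Suc m), v m) \<in> east_steps \<union> south_steps)
       \<and> (\<lambda>m. fst (v m)) \<longlonglongrightarrow> k
       \<and> filterlim (\<lambda>m. snd (v m)) at_top sequentially}"

lemma SE_paths_eq: "SE_paths k n = paths_to k (col_vertex n 0)"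
  by (simp add: SE_paths_def paths_to_def col_vertex_def)

lemma
  assumes "(y, x) \<in> east_steps \<union> south_steps"
  shows steps_fst_mono: "fst y \<le> fst x" and steps_snd_mono: "snd x \<le> snd y"
proof -
  have "fst y \<le> fst x \<and> snd x \<le> snd y"
    using assms
  proof
    assume "(y, x) \<in> east_steps"
    then show ?thesis
      by (auto simp: east_steps_def lh_vertex_def intro!: divide_left_mono)
  next
    assume "(y, x) \<in> south_steps"
    then show ?thesis
      by (auto simp: south_steps_def lh_vertex_def divide_right_mono)
  qed
  then show "fst y \<le> fst x" "snd x \<le> snd y" by auto
qed

lemma
  assumes v: "v \<in> paths_to k x"
  shows paths_to_fst_le: "fst (v m) \<le> fst x" and paths_to_snd_ge: "snd x \<le> snd (v m)"
proof -
  have x: "v 0 = x" and step: "(v (Suc m), v m) \<in> east_steps \<union> south_steps" for m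
    using v by (auto simp: paths_to_def)
  have "fst (v m) \<le> fst x \<and> snd x \<le> snd (v m)"
  proof (induction m)
    case (Suc m)
    then show ?case using steps_fst_mono[OF step[of m]] steps_snd_mono[OF step[of m]] by auto
  qed (simp add: x)
  then show "fst (v m) \<le> fst x" "snd x \<le> snd (v m)" by auto
qed

lemma paths_to_Cons:
  "paths_to k x = (\<Union>y\<in>{y. (y, x) \<in> east_steps \<union> south_steps}. case_nat x ` paths_to k y)"
proof (intro equalityI subsetI)
  fix v assume v: "v \<in> paths_to k x"
  have "v \<circ> Suc \<in> paths_to k (v (Suc 0))"
    using v filterlim_sequentially_Suc[of "\<lambda>m. fst (v m)" "nhds k"]
      filterlim_sequentially_Suc[of "\<lambda>m. snd (v m)" at_top]
    by (auto simp: paths_to_def)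
  moreover have "v = case_nat x (v \<circ> Suc)"
    using v by (auto simp: paths_to_def fun_eq_iff split: nat.split)
  moreover have "(v (Suc 0), x) \<in> east_steps \<union> south_steps"
    using v by (auto simp: paths_to_def)
  ultimately show "v \<in> (\<Union>y\<in>{y. (y, x) \<in> east_steps \<union> south_steps}. case_nat x ` paths_to k y)"
    by blast
next
  fix v assume "v \<in> (\<Union>y\<in>{y. (y, x) \<in> east_steps \<union> south_steps}. case_nat x ` paths_to k y)"
  then obtain y v' where y: "(y, x) \<in> east_steps \<union> south_steps" and v': "v' \<in> paths_to k y"
    and v: "v = case_nat x v'"
    by blast
  have "(v (Suc m), v m) \<in> east_steps \<union> south_steps" for m
    using y v' by (cases m) (auto simp: v paths_to_def)
  then show "v \<in> paths_to k x"
    using v' filterlim_sequentially_Suc[of "\<lambda>m. fst (v m)" "nhds k"]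
      filterlim_sequentially_Suc[of "\<lambda>m. snd (v m)" at_top]
    by (auto simp: v paths_to_def)
qed

lemma inj_case_nat: "inj_on (case_nat x) A"
proof (rule inj_onI)
  fix v v' :: "nat \<Rightarrow> 'a"
  assume "case_nat x v = case_nat x v'"
  then have "case_nat x v (Suc m) = case_nat x v' (Suc m)" for m by simp
  then show "v = v'" by auto
qed

text \<open>The column is eventually constant, so east steps occur only at finitely many positions,
  and an index is determined by the vertex where its step starts. Over an infinite index set the
  product in \<open>path_weight\<close> would default to 1.\<close>

lemma finite_east_indices:
  assumes "v \<in> paths_to k x"
  shows "finite (east_indices v)"
proof -
  have "(\<lambda>m. fst (v m)) \<longlonglongrightarrow> k"
    using assms by (simp add: paths_to_def)
  then have "eventually (\<lambda>m. fst (v m) = k) sequentially"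
    by (simp add: tendsto_discrete)
  then obtain M where M: "\<And>m. M \<le> m \<Longrightarrow> fst (v m) = k"
    by (auto simp: eventually_sequentially)
  define f where "f = (\<lambda>(t, i, j). col_vertex i (t * Suc i + j))"
  have "inj_on f (east_indices v)"
    by (auto simp: inj_on_def f_def mem_east_indices lh_index_eq_iff simp del: mult_Suc_right)
  moreover have "f ` east_indices v \<subseteq> v ` {..M}"
  proof
    fix y assume "y \<in> f ` east_indices v"
    then obtain t i j where tij: "(t, i, j) \<in> east_indices v" and y: "y = col_vertex i (t * Suc i + j)"
      by (auto simp: f_def)
    then obtain m where m: "v (Suc m) = y" "v m = col_vertex (Suc i) (t * Suc (Suc i) + j)"
      by (auto simp: mem_east_indices simp del: mult_Suc_right)
    have "\<not> M \<le> m"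
      using M[of m] M[of "Suc m"] m y by auto
    then show "y \<in> v ` {..M}"
      using m by force
  qed
  ultimately show ?thesis
    by (meson finite_atMost finite_imageI finite_subset inj_on_finite)
qed

lemma east_indices_south:
  assumes "v 0 = col_vertex n (Suc c)"
  shows "east_indices (case_nat (col_vertex n c) v) = east_indices v"
proof -
  have "(t, i, j) \<in> east_indices (case_nat (col_vertex n c) v) \<longleftrightarrow> (t, i, j) \<in> east_indices v" for t i j
    unfolding mem_east_indices
  proof (intro conj_cong refl iffI)
    assume "\<exists>m. case_nat (col_vertex n c) v (Suc m) = col_vertex i (t * Suc i + j) \<and>
        case_nat (col_vertex n c) v m = col_vertex (Suc i) (t * Suc (Suc i) + j)"
    then obtain m where m: "v m = col_vertex i (t * Suc i + j)"
        "case_nat (col_vertex n c) v m = col_vertex (Suc i) (t * Suc (Suc i) + j)" by auto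
    then show "\<exists>m. v (Suc m) = col_vertex i (t * Suc i + j)
        \<and> v m = col_vertex (Suc i) (t * Suc (Suc i) + j)"
      using assms by (cases m) (auto simp del: mult_Suc_right)
  next
    assume "\<exists>m. v (Suc m) = col_vertex i (t * Suc i + j)
        \<and> v m = col_vertex (Suc i) (t * Suc (Suc i) + j)"
    then obtain m where "v (Suc m) = col_vertex i (t * Suc i + j)"
        "v m = col_vertex (Suc i) (t * Suc (Suc i) + j)" by blast
    then show "\<exists>m. case_nat (col_vertex n c) v (Suc m) = col_vertex i (t * Suc i + j) \<and>
        case_nat (col_vertex n c) v m = col_vertex (Suc i) (t * Suc (Suc i) + j)"
      by (intro exI[of _ "Suc m"]) simp
  qed
  then show ?thesis by auto
qed

lemma east_indices_east:
  assumes "v 0 = col_vertex n (s * Suc n + j)" "j \<le> n"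
  shows "east_indices (case_nat (col_vertex (Suc n) (s * Suc (Suc n) + j)) v)
    = insert (s, n, j) (east_indices v)" (is "east_indices (case_nat ?x v) = _")
proof -
  have "(t, i, j') \<in> east_indices (case_nat ?x v)
      \<longleftrightarrow> (t, i, j') \<in> insert (s, n, j) (east_indices v)" for t i j'
  proof
    assume "(t, i, j') \<in> east_indices (case_nat ?x v)"
    then obtain m where m: "v m = col_vertex i (t * Suc i + j')" "j' \<le> i"
        "case_nat ?x v m = col_vertex (Suc i) (t * Suc (Suc i) + j')"
      by (auto simp: mem_east_indices simp del: mult_Suc_right)
    show "(t, i, j') \<in> insert (s, n, j) (east_indices v)"
    proof (cases m)
      case 0
      then have "col_vertex i (t * Suc i + j') = col_vertex n (s * Suc n + j)"
        using m(1) assms(1) by metis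
      then have "i = n" "t * Suc i + j' = s * Suc n + j"
        unfolding col_vertex_eq_iff by blast+
      then show ?thesis
        using m assms lh_index_eq_iff[of j' n j t s] by auto
    next
      case (Suc m')
      then show ?thesis
        using m by (auto simp: mem_east_indices simp del: mult_Suc_right)
    qed
  next
    assume "(t, i, j') \<in> insert (s, n, j) (east_indices v)"
    then consider "(t, i, j') = (s, n, j)" | "(t, i, j') \<in> east_indices v" by blast
    then show "(t, i, j') \<in> east_indices (case_nat ?x v)"
    proof cases
      case 1
      then show ?thesis
        using assms unfolding mem_east_indices by (auto intro!: exI[of _ 0])
    next
      case 2
      then obtain m where "v (Suc m) = col_vertex i (t * Suc i + j')" "j' \<le> i"
        "v m = col_vertex (Suc i) (t * Suc (Suc i) + j')" by (auto simp: mem_east_indices)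
      then show ?thesis
        unfolding mem_east_indices by (auto intro!: exI[of _ "Suc m"])
    qed
  qed
  then show ?thesis by auto
qed

text \<open>Such a path is vertical above height T. These sets serve as finite approximations of the
  infinite set of paths.\<close>

definition low_paths :: "nat \<Rightarrow> nat \<Rightarrow> vertex \<Rightarrow> (nat \<Rightarrow> vertex) set" where
  "low_paths T k x = {v \<in> paths_to k x. \<forall>(t, i, j)\<in>east_indices v. t < T}"

lemma paths_to_start: "v \<in> paths_to k x \<Longrightarrow> v 0 = x"
  by (simp add: paths_to_def)

lemma low_paths_no_west:
  assumes "\<And>y. (y, col_vertex n c) \<notin> east_steps"
  shows "low_paths T k (col_vertex n c)
    = case_nat (col_vertex n c) ` low_paths T k (col_vertex n (Suc c))"
proof -
  have "{y. (y, col_vertex n c) \<in> east_steps \<union> south_steps} = {col_vertex n (Suc c)}"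
    using assms by (auto simp: mem_south_steps)
  then have "paths_to k (col_vertex n c)
      = case_nat (col_vertex n c) ` paths_to k (col_vertex n (Suc c))"
    using paths_to_Cons[of k "col_vertex n c"] by simp
  then show ?thesis
    unfolding low_paths_def by (auto simp: east_indices_south paths_to_start)
qed

lemma low_paths_west:
  fixes n s j :: nat
  assumes "j \<le> n"
  defines "x \<equiv> col_vertex (Suc n) (s * Suc (Suc n) + j)"
  shows "low_paths T k x
    = case_nat x ` low_paths T k (col_vertex (Suc n) (Suc (s * Suc (Suc n) + j)))
      \<union> (if s < T then case_nat x ` low_paths T k (col_vertex n (s * Suc n + j)) else {})"
proof -
  have "{y. (y, x) \<in> east_steps} = {col_vertex n (s * Suc n + j)}"
  proof (intro equalityI subsetI)
    fix y assume "y \<in> {y. (y, x) \<in> east_steps}"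
    then obtain t j' where *: "y = col_vertex n (t * Suc n + j')" "j' \<le> n"
      "s * Suc (Suc n) + j = t * Suc (Suc n) + j'"
      by (auto simp: mem_east_steps x_def simp del: mult_Suc_right)
    then have "s = t \<and> j = j'"
      using assms lh_index_eq_iff[of j "Suc n" j' s t] by simp
    then show "y \<in> {col_vertex n (s * Suc n + j)}"
      using * by simp
  next
    fix y assume "y \<in> {col_vertex n (s * Suc n + j)}"
    then show "y \<in> {y. (y, x) \<in> east_steps}"
      using assms(1) unfolding mem_east_steps x_def by blast
  qed
  then have "{y. (y, x) \<in> east_steps \<union> south_steps}
      = {col_vertex (Suc n) (Suc (s * Suc (Suc n) + j)), col_vertex n (s * Suc n + j)}"
    by (auto simp: mem_south_steps x_def simp del: mult_Suc_right)
  then have "paths_to k x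
      = case_nat x ` paths_to k (col_vertex (Suc n) (Suc (s * Suc (Suc n) + j)))
        \<union> case_nat x ` paths_to k (col_vertex n (s * Suc n + j))"
    using paths_to_Cons[of k x] by simp
  then have "low_paths T k x
      = {v \<in> case_nat x ` paths_to k (col_vertex (Suc n) (Suc (s * Suc (Suc n) + j))).
            \<forall>(t, i, j)\<in>east_indices v. t < T}
        \<union> {v \<in> case_nat x ` paths_to k (col_vertex n (s * Suc n + j)).
            \<forall>(t, i, j)\<in>east_indices v. t < T}"
    unfolding low_paths_def by blast
  also have "{v \<in> case_nat x ` paths_to k (col_vertex (Suc n) (Suc (s * Suc (Suc n) + j))).
            \<forall>(t, i, j)\<in>east_indices v. t < T}
      = case_nat x ` low_paths T k (col_vertex (Suc n) (Suc (s * Suc (Suc n) + j)))"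
    unfolding low_paths_def x_def by (auto simp: east_indices_south paths_to_start simp del: mult_Suc_right)
  also have "{v \<in> case_nat x ` paths_to k (col_vertex n (s * Suc n + j)).
            \<forall>(t, i, j)\<in>east_indices v. t < T}
      = (if s < T then case_nat x ` low_paths T k (col_vertex n (s * Suc n + j)) else {})"
    unfolding low_paths_def x_def using assms(1)
    by (auto simp: east_indices_east paths_to_start simp del: mult_Suc_right)
  finally show ?thesis .
qed

text \<open>Going backwards along a path the height never drops, whereas an east step of level t
  ends below height t + 1. From height T on, a level below T can no longer be used, so only a
  vertical ray remains, and its limit forces the column k.\<close>

lemma
  assumes "T * Suc n \<le> c"
  shows low_paths_high: "low_paths T k (col_vertex n c) = (if n = k then {\<lambda>m. col_vertex n (c + m)} else {})"
    and east_indices_vertical: "east_indices (\<lambda>m. col_vertex n (c + m)) = {}"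
proof -
  show vert: "east_indices (\<lambda>m. col_vertex n (c + m)) = {}"
    by (auto simp: east_indices_def lh_vertex_eq)
  have "v = (\<lambda>m. col_vertex n (c + m)) \<and> n = k" if v: "v \<in> low_paths T k (col_vertex n c)" for v
  proof -
    have v': "v \<in> paths_to k (col_vertex n c)" and T: "\<And>t i j. (t, i, j) \<in> east_indices v \<Longrightarrow> t < T"
      using v by (auto simp: low_paths_def)
    have no_east: "(v (Suc m), v m) \<notin> east_steps" for m
    proof
      assume "(v (Suc m), v m) \<in> east_steps"
      then obtain t i j where e: "v (Suc m) = lh_vertex t i j" "v m = lh_vertex t (Suc i) j" "j \<le> i"
        by (auto simp: east_steps_def)
      then have "t < T"
        using T[of t i j] by (auto simp: east_indices_def)
      moreover have "real j / (real (Suc i) + 1) < 1"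
        using e(3) by simp
      moreover have "real T \<le> real c / (real n + 1)"
      proof -
        have "real (T * Suc n) \<le> real c"
          using assms by (simp only: of_nat_le_iff)
        then show ?thesis by (simp add: field_simps)
      qed
      moreover have "real c / (real n + 1) \<le> real t + real j / (real (Suc i) + 1)"
        using paths_to_snd_ge[OF v', of m] e(2) by (simp add: col_vertex_def lh_vertex_def)
      ultimately have "real T < real t + 1" "real t + 1 \<le> real T"
        by linarith+
      then show False by simp
    qed
    have "v m = col_vertex n (c + m)" for m
    proof (induction m)
      case 0
      then show ?case using paths_to_start[OF v'] by simp
    next
      case (Suc m)
      have "(v (Suc m), v m) \<in> south_steps"
        using v' no_east[of m] by (auto simp: paths_to_def)
      then show ?case
        using Suc by (auto simp: mem_south_steps)
    qed
    then have eq: "v = (\<lambda>m. col_vertex n (c + m))"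
      by auto
    moreover have "n = k"
      using v' LIMSEQ_unique[of "\<lambda>m. n" n k] unfolding eq paths_to_def by auto
    ultimately show ?thesis by simp
  qed
  moreover have "(\<lambda>m. col_vertex k (c + m)) \<in> low_paths T k (col_vertex k c)" if "n = k"
  proof -
    have "filterlim (\<lambda>m. real c + real m) at_top sequentially"
      by (rule filterlim_tendsto_add_at_top[OF tendsto_const filterlim_real_sequentially])
    then have "filterlim (\<lambda>m. real (c + m) * (1 / (real k + 1))) at_top sequentially"
      by (intro filterlim_at_top_mult_tendsto_pos[OF tendsto_const]) auto
    then have "filterlim (\<lambda>m. snd (col_vertex k (c + m))) at_top sequentially"
      by (simp add: col_vertex_def)
    moreover have "(col_vertex k (c + Suc m), col_vertex k (c + m)) \<in> south_steps" for m
      unfolding mem_south_steps by auto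
    ultimately show ?thesis
      using vert unfolding that low_paths_def paths_to_def by simp
  qed
  ultimately show "low_paths T k (col_vertex n c) = (if n = k then {\<lambda>m. col_vertex n (c + m)} else {})"
    by auto
qed

text \<open>Induction on the column and, inside a column, on the distance to height T, where only a
  vertical ray is left.\<close>

lemma finite_low_paths: "finite (low_paths T k (col_vertex n c))"
proof (induction n arbitrary: c)
  case 0
  show ?case
  proof (induction "T - c" arbitrary: c)
    case 0
    then show ?case
      using low_paths_high[of T 0 c k] by simp
  next
    case (Suc d)
    have "low_paths T k (col_vertex 0 c) = case_nat (col_vertex 0 c) ` low_paths T k (col_vertex 0 (Suc c))"
      by (rule low_paths_no_west) (auto simp: mem_east_steps)
    then show ?case
      using Suc(1)[of "Suc c"] Suc(2) by simp
  qed
next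
  case (Suc n)
  show ?case
  proof (induction "T * Suc (Suc n) - c" arbitrary: c)
    case 0
    then show ?case
      using low_paths_high[of T "Suc n" c k] by (simp del: mult_Suc_right)
  next
    case (Suc d)
    then have IH: "finite (low_paths T k (col_vertex (Suc n) (Suc c)))"
      by (simp del: mult_Suc_right)
    define s j where "s = c div Suc (Suc n)" and "j = c mod Suc (Suc n)"
    have c: "c = s * Suc (Suc n) + j"
      by (simp only: s_def j_def div_mult_mod_eq)
    have "j < Suc (Suc n)"
      unfolding j_def by (rule mod_less_divisor) simp
    show ?case
    proof (cases "j \<le> n")
      case True
      then show ?thesis
        using IH \<open>\<And>c. finite (low_paths T k (col_vertex n c))\<close>
        unfolding c low_paths_west[OF True] by simp
    next
      case False
      have "(y, col_vertex (Suc n) c) \<notin> east_steps" for y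
        using False \<open>j < Suc (Suc n)\<close> lh_index_eq_iff[of j "Suc n" _ s]
        by (auto simp: mem_east_steps c simp del: mult_Suc_right)
      then show ?thesis
        using IH low_paths_no_west by simp
    qed
  qed
qed

section \<open>Recursions for the truncated path sums\<close>

definition low_sum :: "(nat \<Rightarrow> nat \<Rightarrow> nat \<Rightarrow> 'a::comm_ring_1) \<Rightarrow> nat \<Rightarrow> nat \<Rightarrow> nat \<Rightarrow> nat \<Rightarrow> 'a" where
  "low_sum w T k n c = sum (path_weight w) (low_paths T k (col_vertex n c))"

lemma path_weight_south:
  assumes "v \<in> low_paths T k (col_vertex n (Suc c))"
  shows "path_weight w (case_nat (col_vertex n c) v) = path_weight w v"
proof -
  have "v 0 = col_vertex n (Suc c)"
    using assms by (auto simp: low_paths_def paths_to_start)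
  then show ?thesis
    by (simp add: path_weight_def east_indices_south)
qed

lemma path_weight_east:
  assumes v: "v \<in> low_paths T k (col_vertex n (s * Suc n + j))" and j: "j \<le> n"
  shows "path_weight w (case_nat (col_vertex (Suc n) (s * Suc (Suc n) + j)) v)
    = w s n j * path_weight w v"
proof -
  have v': "v \<in> paths_to k (col_vertex n (s * Suc n + j))"
    using v by (simp add: low_paths_def)
  \<comment> \<open>A step with this index ends in column n + 1, which a path ending in column n
    never visits. The new weight is therefore a genuinely new factor of the product over the index
    set.\<close>
  have "(s, n, j) \<notin> east_indices v"
  proof
    assume "(s, n, j) \<in> east_indices v"
    then obtain m where "v m = col_vertex (Suc n) (s * Suc (Suc n) + j)"
      by (auto simp: mem_east_indices)
    then show False
      using paths_to_fst_le[OF v', of m] by simp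
  qed
  then show ?thesis
    unfolding path_weight_def east_indices_east[of v, OF paths_to_start[OF v'] j]
    using finite_east_indices[OF v'] by simp
qed

lemma low_sum_high:
  assumes "T * Suc n \<le> c"
  shows "low_sum w T k n c = (if n = k then 1 else 0)"
proof -
  have "path_weight w (\<lambda>m. col_vertex n (c + m)) = 1"
    by (simp add: path_weight_def east_indices_vertical[OF assms])
  then show ?thesis
    unfolding low_sum_def low_paths_high[OF assms] by (cases "n = k") simp_all
qed

lemma low_sum_no_west:
  assumes "\<And>y. (y, col_vertex n c) \<notin> east_steps"
  shows "low_sum w T k n c = low_sum w T k n (Suc c)"
  unfolding low_sum_def low_paths_no_west[OF assms]
  by (subst sum.reindex[OF inj_case_nat]) (simp add: path_weight_south)

lemma low_sum_west:
  assumes "j \<le> n" "s < T"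
  shows "low_sum w T k (Suc n) (s * Suc (Suc n) + j)
    = low_sum w T k (Suc n) (Suc (s * Suc (Suc n) + j)) + w s n j * low_sum w T k n (s * Suc n + j)"
proof -
  define x where "x = col_vertex (Suc n) (s * Suc (Suc n) + j)"
  define A where "A = low_paths T k (col_vertex (Suc n) (Suc (s * Suc (Suc n) + j)))"
  define B where "B = low_paths T k (col_vertex n (s * Suc n + j))"
  have "case_nat x ` A \<inter> case_nat x ` B = {}"
  proof -
    have "case_nat x v \<noteq> case_nat x v'" if "v \<in> A" "v' \<in> B" for v v'
    proof
      assume "case_nat x v = case_nat x v'"
      then have "case_nat x v (Suc 0) = case_nat x v' (Suc 0)" by simp
      then have "v 0 = v' 0" by simp
      moreover have "v 0 = col_vertex (Suc n) (Suc (s * Suc (Suc n) + j))"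
        "v' 0 = col_vertex n (s * Suc n + j)"
        using that by (auto simp: A_def B_def low_paths_def paths_to_start)
      ultimately show False by simp
    qed
    then show ?thesis by blast
  qed
  moreover have "finite (case_nat x ` A)" "finite (case_nat x ` B)"
    by (simp_all add: A_def B_def finite_low_paths)
  ultimately have "sum (path_weight w) (low_paths T k x)
      = sum (path_weight w) (case_nat x ` A) + sum (path_weight w) (case_nat x ` B)"
    using low_paths_west[OF assms(1), of T k s] assms(2)
    unfolding x_def[symmetric] A_def[symmetric] B_def[symmetric] by (simp add: sum.union_disjoint)
  also have "sum (path_weight w) (case_nat x ` A) = sum (path_weight w) A"
    by (subst sum.reindex[OF inj_case_nat]) (simp add: A_def x_def path_weight_south del: mult_Suc_right)
  also have "sum (path_weight w) (case_nat x ` B) = w s n j * sum (path_weight w) B"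
    by (subst sum.reindex[OF inj_case_nat])
       (simp add: B_def x_def path_weight_east assms(1) sum_distrib_left del: mult_Suc_right)
  finally show ?thesis
    by (simp only: low_sum_def x_def A_def B_def)
qed

context generic_q
begin

text \<open>Starting inside the level at position j, all n - l exponents are at least j. This
  contributes q^(j (n - l)) and shrinks the box of the partition, hence the upper index n - j.
  Admitting every j allows induction on the column and, within it, downwards on j.\<close>

lemma low_sum_level:
  assumes w: "\<And>i j. w s i j = u i * q ^ j" and s: "s < T" and j: "j \<le> Suc n"
  shows "low_sum w T k n (s * Suc n + j)
    = (\<Sum>l\<le>n. (\<Prod>i=l..<n. u i) * (q ^ (j * (n - l)) * qb (n - j) (n - l)) * low_sum w T k l (Suc s * Suc l))"
  using j
proof (induction n arbitrary: j)
  case 0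
  have "low_sum w T k 0 s = low_sum w T k 0 (Suc s)"
    by (rule low_sum_no_west) (auto simp: mem_east_steps)
  then show ?case
    using 0 by (cases j) auto
next
  case (Suc n)
  define g where "g l = low_sum w T k l (Suc s * Suc l)" for l
  define S where "S j = (\<Sum>l\<le>Suc n. (\<Prod>i=l..<Suc n. u i)
      * (q ^ (j * (Suc n - l)) * qb (Suc n - j) (Suc n - l)) * g l)" for j
  have "low_sum w T k (Suc n) (s * Suc (Suc n) + j) = S j"
    using Suc.prems
  proof (induction j rule: inc_induct)
    case base
    \<comment> \<open>This position is already the top of the level: the truncated upper index is 0,
      so only l = n + 1 survives.\<close>
    have "S (Suc (Suc n)) = (\<Sum>l\<le>Suc n. if l = Suc n then g l else 0)"
      unfolding S_def by (intro sum.cong refl) (auto simp: qbinom_eq_0 intro!: qbinom_eq_0)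
    also have "\<dots> = g (Suc n)"
      by simp
    also have "\<dots> = low_sum w T k (Suc n) (s * Suc (Suc n) + Suc (Suc n))"
      by (simp only: g_def mult_Suc add.commute)
    finally show ?case ..
  next
    case (step j)
    show ?case
    proof (cases "j \<le> n")
      case False
      then have j: "j = Suc n" using step by simp
      have "(y, col_vertex (Suc n) (s * Suc (Suc n) + j)) \<notin> east_steps" for y
        using False j lh_index_eq_iff[of j "Suc n" _ s]
        by (auto simp: mem_east_steps simp del: mult_Suc_right)
      then have "low_sum w T k (Suc n) (s * Suc (Suc n) + j) = S (Suc j)"
        using step.IH by (subst low_sum_no_west) (simp_all del: mult_Suc_right)
      also have "S (Suc j) = S j"
        unfolding S_def j by (intro sum.cong refl) (auto simp: qbinom_eq_0)
      finally show ?thesis .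
    next
      case True
      have "low_sum w T k (Suc n) (s * Suc (Suc n) + j)
          = S (Suc j) + u n * q ^ j * low_sum w T k n (s * Suc n + j)"
        using step.IH True s by (subst low_sum_west) (simp_all add: w del: mult_Suc_right)
      also have "low_sum w T k n (s * Suc n + j)
          = (\<Sum>l\<le>n. (\<Prod>i=l..<n. u i) * (q ^ (j * (n - l)) * qb (n - j) (n - l)) * g l)"
        unfolding g_def by (rule Suc.IH) (use True in simp)
      also have "S (Suc j) + u n * q ^ j * \<dots> = S j"
      proof -
        define A where "A l = (\<Prod>i=l..<Suc n. u i)
          * (q ^ (Suc j * (Suc n - l)) * qb (Suc n - Suc j) (Suc n - l)) * g l" for l
        define B where "B l = u n * q ^ j
          * ((\<Prod>i=l..<n. u i) * (q ^ (j * (n - l)) * qb (n - j) (n - l)) * g l)" for l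
        define C where "C l = (\<Prod>i=l..<Suc n. u i)
          * (q ^ (j * (Suc n - l)) * qb (Suc n - j) (Suc n - l)) * g l" for l
        \<comment> \<open>Termwise, passing south or coming from the west is the defining Pascal
          rule for \<open>qb (Suc r) (Suc p)\<close> with r = n - j and p = n - l.\<close>
        have ABC: "A l + B l = C l" if "l \<le> n" for l
        proof -
          obtain p where p: "n = l + p"
            using \<open>l \<le> n\<close> le_Suc_ex by blast
          obtain r where r: "n = j + r"
            using True le_Suc_ex by blast
          have diff: "Suc n - l = Suc p" "n - l = p" "Suc n - j = Suc r" "Suc n - Suc j = r" "n - j = r"
            using p r by simp_all
          have prod: "(\<Prod>i=l..<Suc n. u i) = (\<Prod>i=l..<n. u i) * u n"
            using \<open>l \<le> n\<close> by simp
          have pow: "q ^ (Suc j * Suc p) = q ^ j * q ^ (j * p) * q ^ Suc p" "q ^ (j * Suc p) = q ^ j * q ^ (j * p)"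
            by (simp_all add: power_add)
          show ?thesis
            unfolding A_def B_def C_def diff prod pow qbinom.simps(3) ring_distribs
            by (simp only: mult_ac add.commute)
        qed
        have "S (Suc j) = (\<Sum>l\<le>n. A l) + g (Suc n)"
          unfolding S_def sum.atMost_Suc A_def by simp
        moreover have "S j = (\<Sum>l\<le>n. C l) + g (Suc n)"
          unfolding S_def sum.atMost_Suc C_def by simp
        moreover have "(\<Sum>l\<le>n. C l) = (\<Sum>l\<le>n. A l) + (\<Sum>l\<le>n. B l)"
          unfolding sum.distrib[symmetric] using ABC by (intro sum.cong) auto
        ultimately show ?thesis
          unfolding sum_distrib_left B_def by simp
      qed
      finally show ?thesis .
    qed
  qed
  then show ?case
    by (simp only: S_def g_def)
qed

lemma low_sum_level_op:
  assumes "\<And>i j. w s i j = u i * q ^ j" "s < T"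
  shows "low_sum w T k n (s * Suc n) = level_op u (\<lambda>l. low_sum w T k l (Suc s * Suc l)) n"
  using low_sum_level[of w s u T 0 n k] assms
  by (simp add: level_op_def qb_symmetric del: mult_Suc_right mult_Suc)

end

section \<open>Products of the level operators\<close>

definition level_weight :: "'a \<Rightarrow> 'a \<Rightarrow> 'a \<Rightarrow> 'a \<Rightarrow> 'a \<Rightarrow> nat \<Rightarrow> nat \<Rightarrow> 'a::field" where
  "level_weight a b c d q t i = w_AWH a b c d q t i 0"

lemma w_AWH_eq_level_weight: "w_AWH a b c d q t i j = level_weight a b c d q t i * q ^ j"
  by (simp add: level_weight_def w_AWH_def Let_def)

lemma level_weight_initial:
  "level_weight a b c d q 0 = (\<lambda>i. a / 2)" "level_weight a b c d q (Suc 0) = (\<lambda>i. b / 2)"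
  "level_weight a b c d q 2 = (\<lambda>i. c / 2)"
  "level_weight a b c d q 3 = (\<lambda>i. - (a * b) * q ^ i * (c / 2))"
  by (simp_all add: fun_eq_iff level_weight_def w_AWH_def)

text \<open>
  Blocks of eight levels start at \<open>8m + 4\<close>: the factor \<open>- a\<^sup>-\<^sup>1 q\<^sup>-\<^sup>i\<close> of level
  \<open>8(m + 1)\<close> comes with one more factor \<open>abcd q\<^sup>2\<^sup>i\<close>, so it is \<open>- bc q\<^sup>i\<close> relative to the
  beginning of the block.
\<close>

definition block_weight :: "'a \<Rightarrow> 'a \<Rightarrow> 'a \<Rightarrow> 'a \<Rightarrow> 'a \<Rightarrow> nat \<Rightarrow> nat \<Rightarrow> 'a::field" where
  "block_weight a b c d q m i = d / 2 * (a * b * c * d * q ^ (2 * i)) ^ m"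

text \<open>The eight weights are f times the products over all subsets of {-ab q^i, -ac q^i, -bc
  q^i}, in binary order. The nesting of the factors is the one required by repeated use of
  \<open>level_op_combine\<close>.\<close>

lemma level_weight_block:
  fixes a b c d q :: "'a::field" and m i :: nat
  assumes "a \<noteq> 0" "q \<noteq> 0"
  defines "f \<equiv> block_weight a b c d q m i"
  shows "level_weight a b c d q (8 * m + 4) i = f"
    "level_weight a b c d q (8 * m + 5) i = - (a * b) * q ^ i * f"
    "level_weight a b c d q (8 * m + 6) i = - (a * c) * q ^ i * f"
    "level_weight a b c d q (8 * m + 7) i = - (a * b) * q ^ i * (- (a * c) * q ^ i * f)"
    "level_weight a b c d q (8 * m + 8) i = - (b * c) * q ^ i * f"
    "level_weight a b c d q (8 * m + 9) i = - (a * b) * q ^ i * (- (b * c) * q ^ i * f)"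
    "level_weight a b c d q (8 * m + 10) i = - (a * c) * q ^ i * (- (b * c) * q ^ i * f)"
    "level_weight a b c d q (8 * m + 11) i
       = - (a * b) * q ^ i * (- (a * c) * q ^ i * (- (b * c) * q ^ i * f))"
proof -
  have q2: "q ^ (2 * i) = q ^ i * q ^ i"
    by (simp add: mult_2 power_add)
  have d0: "(8 * m + 4) div 8 = m" "(8 * m + 5) div 8 = m" "(8 * m + 6) div 8 = m"
    "(8 * m + 7) div 8 = m"
    by simp_all
  have d1: "8 * m + 8 = 8 * Suc m + 0" "8 * m + 9 = 8 * Suc m + 1" "8 * m + 10 = 8 * Suc m + 2"
    "8 * m + 11 = 8 * Suc m + 3"
    by simp_all
  have d2: "(8 * Suc m + r) div 8 = Suc m" if "r < 8" for r
    using that div_mult_self4[of 8 "Suc m" r] by (simp del: mult_Suc_right)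
  have d2: "(8 * Suc m + 0) div 8 = Suc m" "(8 * Suc m + 1) div 8 = Suc m"
    "(8 * Suc m + 2) div 8 = Suc m" "(8 * Suc m + 3) div 8 = Suc m"
    by (rule d2, simp)+
  show "level_weight a b c d q (8 * m + 4) i = f"
    "level_weight a b c d q (8 * m + 5) i = - (a * b) * q ^ i * f"
    "level_weight a b c d q (8 * m + 6) i = - (a * c) * q ^ i * f"
    "level_weight a b c d q (8 * m + 7) i = - (a * b) * q ^ i * (- (a * c) * q ^ i * f)"
    unfolding level_weight_def w_AWH_def Let_def d0 f_def block_weight_def q2
    by (simp_all add: q2 power2_eq_square mult_ac)
  define p Y where "p = q ^ i" and "Y = (a * b * c * d * (p * p)) ^ m"
  have p: "q powi (- int i) = inverse p" "q ^ (2 * i) = p * p" "p \<noteq> 0"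
    using assms by (simp_all add: p_def q2 power_int_minus)
  have X: "(a * b * c * d * (p * p)) ^ Suc m = Y * (a * b * c * d * (p * p))"
    unfolding Y_def power_Suc by (simp only: mult_ac)
  \<comment> \<open>Needed at level 8m + 8 only, to cancel its negative powers of a and q against
    the additional factor abcd q^(2i).\<close>
  have ap: "a * (p * (inverse a * inverse p)) = 1"
    using assms(1) p(3) by (simp add: field_simps)
  have f: "f = d / 2 * Y"
    by (simp add: f_def block_weight_def Y_def p(2))
  show "level_weight a b c d q (8 * m + 8) i = - (b * c) * q ^ i * f"
    "level_weight a b c d q (8 * m + 9) i = - (a * b) * q ^ i * (- (b * c) * q ^ i * f)"
    "level_weight a b c d q (8 * m + 10) i = - (a * c) * q ^ i * (- (b * c) * q ^ i * f)"
    "level_weight a b c d q (8 * m + 11) i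
       = - (a * b) * q ^ i * (- (a * c) * q ^ i * (- (b * c) * q ^ i * f))"
    unfolding level_weight_def w_AWH_def Let_def d1 d2 f p(1) p(2) X p_def[symmetric]
    using assms(1) p(3) ap by (simp_all add: power2_eq_square)
qed

context generic_q
begin

section \<open>Composing the levels and collapsing the blocks\<close>

primrec levels :: "(nat \<Rightarrow> nat \<Rightarrow> 'a) \<Rightarrow> nat \<Rightarrow> nat \<Rightarrow> (nat \<Rightarrow> 'a) \<Rightarrow> nat \<Rightarrow> 'a" where
  "levels u s 0 v = v"
| "levels u s (Suc N) v = level_op (u s) (levels u (Suc s) N v)"

lemma levels_add: "levels u s (N + M) v = levels u s N (levels u (s + N) M v)"
  by (induction N arbitrary: s) simp_all

lemma level_op_diff:
  "level_op u (\<lambda>n. v n - v' n) = (\<lambda>n. level_op u v n - level_op u v' n)"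
  by (simp add: fun_eq_iff level_op_def right_diff_distrib sum_subtractf)

lemma levels_diff:
  "levels u s N (\<lambda>n. v n - v' n) = (\<lambda>n. levels u s N v n - levels u s N v' n)"
  by (induction N arbitrary: s) (simp_all add: level_op_diff)

lemma levels_4: "levels u s 4 v = level_op (u s) (level_op (u (s + 1)) (level_op (u (s + 2))
    (level_op (u (s + 3)) v)))"
  by (simp add: eval_nat_numeral)

lemma low_sum_levels:
  assumes "\<And>t i j. w t i j = u t i * q ^ j"
  shows "s + N = T \<Longrightarrow>
    (\<lambda>n. low_sum w T k n (s * Suc n)) = levels u s N (\<lambda>n. if n = k then 1 else 0)"
proof (induction N arbitrary: s)
  case 0
  then show ?case
    by (simp add: low_sum_high del: mult_Suc_right)
next
  case (Suc N)
  have "low_sum w T k n (s * Suc n) = level_op (u s) (\<lambda>l. low_sum w T k l (Suc s * Suc l)) n" for n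
    using Suc.prems assms by (intro low_sum_level_op) auto
  then show ?case
    using Suc.IH[of "Suc s"] Suc.prems by (simp del: mult_Suc mult_Suc_right)
qed

text \<open>Column \<open>k\<close> of the infinite product of the level operators from level \<open>8m + 4\<close> on.\<close>

definition block_col :: "'a \<Rightarrow> 'a \<Rightarrow> 'a \<Rightarrow> 'a \<Rightarrow> nat \<Rightarrow> nat \<Rightarrow> nat \<Rightarrow> 'a" where
  "block_col a b c d k m n = qb n k * (\<Prod>i=k..<n. (1 - b * c * q ^ i) * ((1 - a * c * q ^ i)
      * ((1 - a * b * q ^ i) * block_weight a b c d q m i)) / (1 - a * b * c * d * q ^ (k + i)))"

lemma block_col_0: "block_col a b c d k 0 = (\<lambda>n. connection_coeff a b c d n k)"
  by (simp add: fun_eq_iff block_col_def connection_coeff_def block_weight_def mult_ac)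

text \<open>Eight levels merge pairwise to four, two and one, with the factors commuted in between
  to restore the shape of \<open>level_op_combine\<close>. The fact \<open>four\<close> serves both
  halves of the block, with f and with -bc q^i f in the role of g.\<close>

lemma levels_block:
  assumes "a \<noteq> 0"
  shows "levels (level_weight a b c d q) (8 * m + 4) 8 v
    = level_op (\<lambda>i. (1 - b * c * q ^ i) * ((1 - a * c * q ^ i)
        * ((1 - a * b * q ^ i) * block_weight a b c d q m i))) v"
proof -
  define f where "f = block_weight a b c d q m"
  have four: "level_op g (level_op (\<lambda>i. - (a * b) * q ^ i * g i) (level_op (\<lambda>i. - (a * c) * q ^ i * g i)
      (level_op (\<lambda>i. - (a * b) * q ^ i * (- (a * c) * q ^ i * g i)) v)))
    = level_op (\<lambda>i. (1 - a * c * q ^ i) * ((1 - a * b * q ^ i) * g i)) v" for g v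
  proof -
    have "(\<lambda>i. (1 - a * b * q ^ i) * (- (a * c) * q ^ i * g i))
        = (\<lambda>i. - (a * c) * q ^ i * ((1 - a * b * q ^ i) * g i))"
      by (simp add: mult_ac)
    then show ?thesis
      unfolding level_op_combine by (simp only: level_op_combine)
  qed
  have swap: "(\<lambda>i. (1 - a * c * q ^ i) * ((1 - a * b * q ^ i) * (- (b * c) * q ^ i * f i)))
      = (\<lambda>i. - (b * c) * q ^ i * ((1 - a * c * q ^ i) * ((1 - a * b * q ^ i) * f i)))"
    by (simp add: mult_ac)
  have lw: "level_weight a b c d q (8 * m + 4) = f"
    "level_weight a b c d q (8 * m + 5) = (\<lambda>i. - (a * b) * q ^ i * f i)"
    "level_weight a b c d q (8 * m + 6) = (\<lambda>i. - (a * c) * q ^ i * f i)"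
    "level_weight a b c d q (8 * m + 7) = (\<lambda>i. - (a * b) * q ^ i * (- (a * c) * q ^ i * f i))"
    "level_weight a b c d q (8 * m + 8) = (\<lambda>i. - (b * c) * q ^ i * f i)"
    "level_weight a b c d q (8 * m + 9) = (\<lambda>i. - (a * b) * q ^ i * (- (b * c) * q ^ i * f i))"
    "level_weight a b c d q (8 * m + 10) = (\<lambda>i. - (a * c) * q ^ i * (- (b * c) * q ^ i * f i))"
    "level_weight a b c d q (8 * m + 11)
      = (\<lambda>i. - (a * b) * q ^ i * (- (a * c) * q ^ i * (- (b * c) * q ^ i * f i)))"
    by (simp_all only: fun_eq_iff level_weight_block[OF assms q_nz] f_def simp_thms)
  have "levels (level_weight a b c d q) (8 * m + 4) 8 v
      = level_op (level_weight a b c d q (8 * m + 4)) (level_op (level_weight a b c d q (8 * m + 5))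
        (level_op (level_weight a b c d q (8 * m + 6)) (level_op (level_weight a b c d q (8 * m + 7))
        (level_op (level_weight a b c d q (8 * m + 8)) (level_op (level_weight a b c d q (8 * m + 9))
        (level_op (level_weight a b c d q (8 * m + 10)) (level_op (level_weight a b c d q (8 * m + 11)) v)))))))"
    using levels_add[of "level_weight a b c d q" "8 * m + 4" 4 4 v] by (simp add: levels_4 add.commute)
  also have "\<dots> = level_op (\<lambda>i. (1 - b * c * q ^ i) * ((1 - a * c * q ^ i) * ((1 - a * b * q ^ i) * f i))) v"
    unfolding lw unfolding four unfolding swap level_op_combine ..
  finally show ?thesis
    unfolding f_def .
qed

text \<open>After multiplication by the full denominator P this is \<open>durfee_sum\<close> with N
  = n - k and x = D q^(2k).\<close>

lemma durfee_quotient_sum: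
  assumes D: "\<And>m. D * q ^ m \<noteq> 1" and k: "k \<le> n"
  shows "(\<Sum>l=k..n. qb (n - k) (l - k) * (\<Prod>i=k..<l. D * q ^ (2 * i) / (1 - D * q ^ (k + i))))
    = (\<Prod>i=k..<n. 1 / (1 - D * q ^ (k + i)))"
proof -
  define x where "x = D * q ^ (k + k)"
  have x1: "x * q ^ i = D * q ^ (k + (i + k))" for i
    by (simp only: x_def power_add mult_ac)
  have x2: "x * q ^ (2 * i) = D * q ^ (2 * (i + k))" for i
  proof -
    have "2 * (i + k) = k + k + 2 * i" by simp
    then show ?thesis by (simp only: x_def power_add mult_ac)
  qed
  have nz: "1 - D * q ^ m \<noteq> 0" for m
    using D[of m] by simp
  define P where "P = (\<Prod>i=k..<n. 1 - D * q ^ (k + i))"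
  have "(\<Sum>l=k..n. qb (n - k) (l - k) * (\<Prod>i=k..<l. D * q ^ (2 * i) / (1 - D * q ^ (k + i)))) * P
    = (\<Sum>r\<le>n - k. qb (n - k) r * ((\<Prod>i<r. x * q ^ (2 * i)) * (\<Prod>i=r..<n - k. 1 - x * q ^ i)))"
    unfolding sum_distrib_right
  proof (rule sum.reindex_bij_witness[of _ "\<lambda>r. r + k" "\<lambda>l. l - k"])
    fix l assume l: "l \<in> {k..n}"
    have "(\<Prod>i<l - k. x * q ^ (2 * i)) = (\<Prod>i=k..<l. D * q ^ (2 * i))"
      by (rule prod.reindex_bij_witness[of _ "\<lambda>i. i - k" "\<lambda>i. i + k"]) (use l in \<open>auto simp: x2\<close>)
    moreover have "(\<Prod>i=l - k..<n - k. 1 - x * q ^ i) = (\<Prod>i=l..<n. 1 - D * q ^ (k + i))"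
      by (rule prod.reindex_bij_witness[of _ "\<lambda>i. i - k" "\<lambda>i. i + k"]) (use l in \<open>auto simp: x1\<close>)
    moreover have "P = (\<Prod>i=k..<l. 1 - D * q ^ (k + i)) * (\<Prod>i=l..<n. 1 - D * q ^ (k + i))"
      using l by (simp add: P_def prod.atLeastLessThan_concat)
    moreover have "(\<Prod>i=k..<l. 1 - D * q ^ (k + i)) \<noteq> 0"
      using nz by (simp only: prod_zero_iff finite_atLeastLessThan) blast
    ultimately show "qb (n - k) (l - k) * ((\<Prod>i<l - k. x * q ^ (2 * i)) * (\<Prod>i=l - k..<n - k. 1 - x * q ^ i))
        = qb (n - k) (l - k) * (\<Prod>i=k..<l. D * q ^ (2 * i) / (1 - D * q ^ (k + i))) * P"
      by (simp add: prod_dividef)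
  qed (use k in auto)
  also have "\<dots> = 1"
    by (rule durfee_sum)
  finally have "(\<Sum>l=k..n. qb (n - k) (l - k) * (\<Prod>i=k..<l. D * q ^ (2 * i) / (1 - D * q ^ (k + i)))) * P = 1" .
  moreover have "(\<Prod>i=k..<n. 1 / (1 - D * q ^ (k + i))) = 1 / P"
    by (simp add: P_def prod_dividef)
  moreover have "X = 1 / Y" if "X * Y = 1" for X Y :: 'a
    using that by (auto simp: eq_divide_eq)
  ultimately show ?thesis
    by presburger
qed

text \<open>The next column contains the weights E of the current block times abcd q^(2i). Taking
  the E and \<open>qb n k\<close> out of the sum leaves the Durfee quotient, which restores the
  denominators of the current column.\<close>

lemma block_col_step:
  assumes a: "a \<noteq> 0" and D: "\<And>m. a * b * c * d * q ^ m \<noteq> 1"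
  shows "levels (level_weight a b c d q) (8 * m + 4) 8 (block_col a b c d k (Suc m))
    = block_col a b c d k m"
proof
  fix n
  define D' where "D' = a * b * c * d"
  define E where "E i = (1 - b * c * q ^ i) * ((1 - a * c * q ^ i)
        * ((1 - a * b * q ^ i) * block_weight a b c d q m i))" for i
  have col: "block_col a b c d k (Suc m) l
      = qb l k * ((\<Prod>i=k..<l. E i) * (\<Prod>i=k..<l. D' * q ^ (2 * i) / (1 - D' * q ^ (k + i))))" for l
    unfolding block_col_def prod.distrib[symmetric]
    by (simp add: E_def block_weight_def D'_def mult_ac)
  have "levels (level_weight a b c d q) (8 * m + 4) 8 (block_col a b c d k (Suc m)) n
      = (\<Sum>l\<le>n. (\<Prod>i=l..<n. E i) * qb n l * block_col a b c d k (Suc m) l)"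
    unfolding levels_block[OF a] level_op_def E_def ..
  also have "\<dots> = (\<Sum>l=k..n. (\<Prod>i=l..<n. E i) * qb n l * block_col a b c d k (Suc m) l)"
    by (rule sum.mono_neutral_right) (auto simp: block_col_def qbinom_eq_0)
  also have "\<dots> = (\<Sum>l=k..n. qb n k * (\<Prod>i=k..<n. E i)
      * (qb (n - k) (l - k) * (\<Prod>i=k..<l. D' * q ^ (2 * i) / (1 - D' * q ^ (k + i)))))"
  proof (intro sum.cong refl)
    fix l assume "l \<in> {k..n}"
    then have l: "k \<le> l" "l \<le> n" by auto
    have "(\<Prod>i=k..<n. E i) = (\<Prod>i=k..<l. E i) * (\<Prod>i=l..<n. E i)"
      using l by (simp add: prod.atLeastLessThan_concat)
    then show "(\<Prod>i=l..<n. E i) * qb n l * block_col a b c d k (Suc m) l = qb n k * (\<Prod>i=k..<n. E i)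
      * (qb (n - k) (l - k) * (\<Prod>i=k..<l. D' * q ^ (2 * i) / (1 - D' * q ^ (k + i))))"
      using qb_trinomial[OF l] unfolding col by (simp add: mult_ac)
  qed
  also have "\<dots> = block_col a b c d k m n"
  proof (cases "k \<le> n")
    case True
    have "(\<Prod>i=k..<n. E i) * (\<Prod>i=k..<n. 1 / (1 - D' * q ^ (k + i)))
        = (\<Prod>i=k..<n. E i / (1 - D' * q ^ (k + i)))"
      unfolding prod.distrib[symmetric] by simp
    then show ?thesis
      unfolding sum_distrib_left[symmetric] durfee_quotient_sum[OF D[folded D'_def] True]
      by (simp add: block_col_def E_def D'_def mult.assoc)
  next
    case False
    then show ?thesis by (simp add: block_col_def qbinom_eq_0)
  qed
  finally show "levels (level_weight a b c d q) (8 * m + 4) 8 (block_col a b c d k (Suc m)) n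
    = block_col a b c d k m n" .
qed

text \<open>Here m is arbitrary: cutting at any block boundary gives an exact identity, so
  convergence only requires an estimate for the column left at the top.\<close>

lemma moment_col_eq_levels:
  assumes a: "a \<noteq> 0" and D: "\<And>m. a * b * c * d * q ^ m \<noteq> 1"
  shows "moment_col a b c d k = levels (level_weight a b c d q) 0 (8 * m + 4) (block_col a b c d k m)"
proof -
  let ?u = "level_weight a b c d q"
  have "levels ?u 0 (8 * m + 4) (block_col a b c d k m) = levels ?u 0 4 (block_col a b c d k 0)"
  proof (induction m)
    case (Suc m)
    have "levels ?u 0 (8 * Suc m + 4) (block_col a b c d k (Suc m))
        = levels ?u 0 (8 * m + 4) (levels ?u (8 * m + 4) 8 (block_col a b c d k (Suc m)))"
      using levels_add[of ?u 0 "8 * m + 4" 8] by (simp add: add.commute)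
    then show ?case
      unfolding block_col_step[OF a D] Suc .
  qed simp
  also have "\<dots> = level_op (?u 0) (level_op (?u (Suc 0)) (level_op (?u 2) (level_op (?u 3) (block_col a b c d k 0))))"
    by (simp add: levels_4 eval_nat_numeral)
  also have "\<dots> = moment_col a b c d k"
    unfolding moment_col_def by (simp only: block_col_0 level_weight_initial)
  finally show ?thesis ..
qed

end

section \<open>Convergence of the path sums\<close>

text \<open>A lower bound for the a-adic order when the variable of the series is a. It is stated
  through coefficients because \<open>fls_subdegree\<close> assigns 0 to the zero series.\<close>

definition ord_ge :: "nat \<Rightarrow> 'a::field fls \<Rightarrow> bool" where
  "ord_ge N x \<longleftrightarrow> (\<forall>i < int N. fls_nth x i = 0)"

lemma ord_ge_iff: "ord_ge N x \<longleftrightarrow> x = 0 \<or> int N \<le> fls_subdegree x"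
proof (cases "x = 0")
  case False
  then have "ord_ge N x \<Longrightarrow> int N \<le> fls_subdegree x"
    unfolding ord_ge_def by (intro fls_subdegree_geI) auto
  then show ?thesis
    using False by (auto simp: ord_ge_def)
qed (simp add: ord_ge_def)

lemma ord_ge_mono: "ord_ge N x \<Longrightarrow> M \<le> N \<Longrightarrow> ord_ge M x"
  by (auto simp: ord_ge_def)

lemma ord_ge_0 [simp]: "ord_ge N 0"
  by (simp add: ord_ge_def)

lemma ord_ge_const [simp]: "ord_ge 0 (fls_const c)"
  by (simp add: ord_ge_def)

lemma ord_ge_1 [simp]: "ord_ge 0 1"
  using ord_ge_const[of 1] by simp

lemma ord_ge_half [simp]: "ord_ge 0 (1 / 2)"
proof -
  have "(1 / 2 :: 'a fls) = inverse (fls_const 2)"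
    by (simp add: inverse_eq_divide)
  also have "\<dots> = fls_const (inverse 2)"
    by (rule fls_inverse_const)
  finally show ?thesis
    by (simp only: ord_ge_const)
qed

lemma ord_ge_add: "ord_ge N x \<Longrightarrow> ord_ge N y \<Longrightarrow> ord_ge N (x + y)"
  by (simp add: ord_ge_def)

lemma ord_ge_diff: "ord_ge N x \<Longrightarrow> ord_ge N y \<Longrightarrow> ord_ge N (x - y)"
  by (simp add: ord_ge_def)

lemma ord_ge_uminus: "ord_ge N x \<Longrightarrow> ord_ge N (- x)"
  by (simp add: ord_ge_def)

lemma ord_ge_mult: "ord_ge N x \<Longrightarrow> ord_ge M y \<Longrightarrow> ord_ge (N + M) (x * y)"
  by (cases "x = 0 \<or> y = 0") (auto simp: ord_ge_iff)

lemma ord_ge_mult_0: "ord_ge 0 x \<Longrightarrow> ord_ge N y \<Longrightarrow> ord_ge N (x * y)"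
  using ord_ge_mult[of 0 x N y] by simp

lemma ord_ge_power_0: "ord_ge 0 x \<Longrightarrow> ord_ge 0 (x ^ n)"
  by (induction n) (auto intro: ord_ge_mult_0)

lemma ord_ge_power: "ord_ge 1 x \<Longrightarrow> ord_ge n (x ^ n)"
  by (induction n) (use ord_ge_mult[of 1 x] in auto)

lemma ord_ge_sum: "(\<And>i. i \<in> A \<Longrightarrow> ord_ge N (f i)) \<Longrightarrow> ord_ge N (sum f A)"
  by (induction A rule: infinite_finite_induct) (auto intro: ord_ge_add)

lemma ord_ge_prod_0: "(\<And>i. i \<in> A \<Longrightarrow> ord_ge 0 (f i)) \<Longrightarrow> ord_ge 0 (prod f A)"
  by (induction A rule: infinite_finite_induct) (auto intro: ord_ge_mult_0)

lemma ord_ge_prod: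
  assumes "finite A" "x \<in> A" "ord_ge N (f x)" "\<And>i. i \<in> A \<Longrightarrow> ord_ge 0 (f i)"
  shows "ord_ge N (prod f A)"
proof -
  have "ord_ge 0 (prod f (A - {x}))"
    using assms(4) by (intro ord_ge_prod_0) auto
  then have "ord_ge N (prod f (A - {x}) * f x)"
    using assms(3) by (rule ord_ge_mult_0)
  then show ?thesis
    by (simp add: prod.remove[OF assms(1,2)] mult.commute)
qed

lemma ord_ge_inverse:
  assumes "ord_ge 1 y"
  shows "ord_ge 0 (inverse (1 - y))"
proof -
  have "fls_subdegree (1 - y) = 0"
    using assms by (intro fls_subdegree_eqI) (auto simp: ord_ge_def)
  then show ?thesis
    by (simp add: ord_ge_iff)
qed

text \<open>The Pascal recursion defining \<open>qbinom\<close> is free of divisions, so an integral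
  q suffices.\<close>

lemma ord_ge_qbinom: "ord_ge 0 q \<Longrightarrow> ord_ge 0 (qbinom q n k)"
  by (induction q n k rule: qbinom.induct)
     (auto intro!: ord_ge_add ord_ge_mult_0 ord_ge_power_0 simp del: power_Suc)

lemma dist_le_if_ord_ge:
  assumes "ord_ge N (x - y)"
  shows "dist x y \<le> inverse (2 ^ N)"
proof (cases "x = y")
  case False
  then have "int N \<le> fls_subdegree (x - y)"
    using assms by (simp add: ord_ge_iff)
  then show ?thesis
    using False by (auto simp: dist_fls_def le_nat_iff intro!: le_imp_inverse_le power_increasing)
qed simp

section \<open>The a-adic estimates for weights, tails and path sums\<close>

locale generic_q_fls = generic_q q for q :: "'a::field fls" +
  assumes ord_q: "ord_ge 0 q"
begin

lemma level_op_ord_ge: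
  assumes "\<And>i. ord_ge 0 (u i)" "\<And>n. ord_ge N (v n)"
  shows "ord_ge N (level_op u v n)"
  unfolding level_op_def
  by (intro ord_ge_sum ord_ge_mult_0 ord_ge_prod_0 ord_ge_qbinom ord_q assms)

lemma levels_ord_ge:
  assumes "\<And>t i. ord_ge 0 (u t i)" "\<And>n. ord_ge N (v n)"
  shows "ord_ge N (levels u s M v n)"
proof (induction M arbitrary: s n)
  case 0
  then show ?case using assms(2) by simp
next
  case (Suc M)
  then show ?case using assms(1) by (auto intro: level_op_ord_ge)
qed

context
  fixes a b c d :: "'a fls"
  assumes a: "a \<noteq> 0" and ord_a: "ord_ge 1 a"
    and ord_b: "ord_ge 0 b" and ord_c: "ord_ge 0 c" and ord_d: "ord_ge 0 d"
begin

lemma ord_a': "ord_ge 0 a"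
  using ord_a by (rule ord_ge_mono) simp

lemma ord_abcd: "ord_ge 1 (a * b * c * d * q ^ m)"
  using ord_ge_mult_0[OF ord_ge_power_0[OF ord_q, of m]
      ord_ge_mult_0[OF ord_d ord_ge_mult_0[OF ord_c ord_ge_mult_0[OF ord_b ord_a]]]]
  by (simp add: mult_ac)

lemma abcd_neq_1: "a * b * c * d * q ^ m \<noteq> 1"
  using ord_abcd[of m] by (auto simp: ord_ge_def dest: spec[of _ 0])

lemma ord_block_weight: "ord_ge m (block_weight a b c d q m i)"
proof -
  have "ord_ge m (d * (1 / 2 * (a * b * c * d * q ^ (2 * i)) ^ m))"
    by (intro ord_ge_mult_0 ord_d ord_ge_half ord_ge_power ord_abcd)
  then show ?thesis
    by (simp add: block_weight_def)
qed

text \<open>Counting blocks from level 4 absorbs the inverse of a at the levels divisible by 8. For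
  t < 4 the truncated subtraction gives the bound 0.\<close>

lemma ord_level_weight: "ord_ge ((t - 4) div 8) (level_weight a b c d q t i)"
proof (cases "t < 4")
  case True
  then have "t = 0 \<or> t = Suc 0 \<or> t = 2 \<or> t = 3" by auto
  moreover have half: "ord_ge 0 (x / 2)" if "ord_ge 0 x" for x :: "'a fls"
    using ord_ge_mult_0[OF ord_ge_half that] by simp
  ultimately have "ord_ge 0 (level_weight a b c d q t i)"
    by (elim disjE; simp only: level_weight_initial)
       (intro half ord_ge_mult_0 ord_ge_uminus ord_ge_power_0 ord_q ord_a' ord_b ord_c)+
  then show ?thesis
    using True by simp
next
  case False
  define m r where "m = (t - 4) div 8" and "r = (t - 4) mod 8"
  have t: "t = 8 * m + (r + 4)"
  proof -
    have "8 * m + r = t - 4"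
      unfolding m_def r_def by (rule mult_div_mod_eq)
    then show ?thesis
      using False by linarith
  qed
  have "r < 8"
    by (simp add: r_def)
  then have r4: "r + 4 = 4 \<or> r + 4 = 5 \<or> r + 4 = 6 \<or> r + 4 = 7
      \<or> r + 4 = 8 \<or> r + 4 = 9 \<or> r + 4 = 10 \<or> r + 4 = 11"
    by presburger
  have ab: "ord_ge m (- (a * b) * q ^ i * x)" if "ord_ge m x" for x
    by (intro ord_ge_mult_0 ord_ge_uminus ord_ge_power_0 ord_q ord_a' ord_b that)
  have ac: "ord_ge m (- (a * c) * q ^ i * x)" if "ord_ge m x" for x
    by (intro ord_ge_mult_0 ord_ge_uminus ord_ge_power_0 ord_q ord_a' ord_c that)
  have bc: "ord_ge m (- (b * c) * q ^ i * x)" if "ord_ge m x" for x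
    by (intro ord_ge_mult_0 ord_ge_uminus ord_ge_power_0 ord_q ord_b ord_c that)
  have "ord_ge m (level_weight a b c d q (8 * m + (r + 4)) i)"
    using r4
    by (elim disjE; simp only: level_weight_block[OF a q_nz])
       (intro ab ac bc ord_block_weight)+
  then show ?thesis
    by (simp only: t[symmetric] m_def[symmetric])
qed

lemma ord_level_weight_0: "ord_ge 0 (level_weight a b c d q t i)"
  by (rule ord_ge_mono[OF ord_level_weight]) simp

text \<open>The diagonal entry is exactly 1. For k < n the product is not empty: its factor at i = k
  contains \<open>block_weight\<close>, of order m, and all other factors are integral.\<close>

lemma ord_block_col: "ord_ge m (block_col a b c d k m n - (if n = k then 1 else 0))"
proof -
  consider "n < k" | "n = k" | "k < n" by linarith
  then show ?thesis
  proof cases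
    case 1
    then show ?thesis by (simp add: block_col_def qbinom_eq_0)
  next
    case 2
    then show ?thesis by (simp add: block_col_def)
  next
    case 3
    have *: "ord_ge m ((1 - b * c * q ^ i) * ((1 - a * c * q ^ i)
        * ((1 - a * b * q ^ i) * block_weight a b c d q m i)) / (1 - a * b * c * d * q ^ (k + i)))" for i
    proof -
      have "ord_ge m (inverse (1 - a * b * c * d * q ^ (k + i)) * ((1 - b * c * q ^ i)
          * ((1 - a * c * q ^ i) * ((1 - a * b * q ^ i) * block_weight a b c d q m i))))"
        by (intro ord_ge_mult_0 ord_ge_diff ord_ge_1 ord_ge_inverse ord_abcd ord_block_weight
            ord_ge_power_0 ord_q ord_a' ord_b ord_c)
      then show ?thesis
        by (simp only: divide_inverse mult.commute)
    qed
    have "ord_ge m (block_col a b c d k m n)"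
      unfolding block_col_def using 3
      by (intro ord_ge_mult_0 ord_ge_qbinom ord_q ord_ge_prod[of _ k] * ord_ge_mono[OF *]) auto
    then show ?thesis
      using 3 by simp
  qed
qed

text \<open>A path outside the truncated set has an east step in level 8m + 4 or above, whose weight
  has order m; its other weights have nonnegative order.\<close>

lemma ord_path_weight:
  assumes v: "v \<in> paths_to k x" "v \<notin> low_paths (8 * m + 4) k x"
  shows "ord_ge m (path_weight (w_AWH a b c d q) v)"
proof -
  obtain t i j where tij: "(t, i, j) \<in> east_indices v" "8 * m + 4 \<le> t"
    using v by (auto simp: low_paths_def not_less)
  have weight: "ord_ge ((t - 4) div 8) (w_AWH a b c d q t i j)" for t i j
    using ord_ge_mult_0[OF ord_ge_power_0[OF ord_q, of j] ord_level_weight[of t i]]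
    by (simp add: w_AWH_eq_level_weight mult.commute)
  have "m \<le> (t - 4) div 8"
    using tij(2) by presburger
  then show ?thesis
    unfolding path_weight_def
    using finite_east_indices[OF v(1)] tij(1)
    by (intro ord_ge_prod[of _ "(t, i, j)"]) (auto intro: ord_ge_mono[OF weight])
qed

text \<open>For a finite F containing the truncated paths there are two errors, both of order m: the
  remaining paths in F, and the levels below 8m + 4 applied to \<open>block_col\<close> minus the
  unit column. Levels with integral weights do not lower the order.\<close>

lemma has_sum_path_weight:
  "(path_weight (w_AWH a b c d q) has_sum moment_col a b c d k n) (SE_paths k n)"
  unfolding has_sum_def tendsto_iff
proof (intro allI impI)
  fix e :: real assume "e > 0"
  then obtain m where m: "inverse (2 ^ m) < e"
    using reals_power_lt_ex[of e 2] by (auto simp: field_simps power_one_over)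
  let ?w = "path_weight (w_AWH a b c d q)" and ?low = "low_paths (8 * m + 4) k (col_vertex n 0)"
  have sub: "?low \<subseteq> SE_paths k n"
    by (auto simp: low_paths_def SE_paths_eq)
  have "dist (sum ?w F) (moment_col a b c d k n) < e"
    if F: "finite F" "?low \<subseteq> F" "F \<subseteq> SE_paths k n" for F
  proof -
    have "sum ?w ?low = levels (level_weight a b c d q) 0 (8 * m + 4) (\<lambda>n. if n = k then 1 else 0) n"
      using fun_cong[OF low_sum_levels[where w = "w_AWH a b c d q" and s = 0 and N = "8 * m + 4"
          and T = "8 * m + 4" and k = k and u = "level_weight a b c d q"], of n]
      by (simp add: w_AWH_eq_level_weight low_sum_def)
    moreover have "moment_col a b c d k n
        = levels (level_weight a b c d q) 0 (8 * m + 4) (block_col a b c d k m) n"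
      by (simp only: moment_col_eq_levels[OF a abcd_neq_1, of k m])
    ultimately have "moment_col a b c d k n - sum ?w ?low = levels (level_weight a b c d q) 0 (8 * m + 4)
        (\<lambda>n. block_col a b c d k m n - (if n = k then 1 else 0)) n"
      by (simp only: levels_diff)
    then have 1: "ord_ge m (moment_col a b c d k n - sum ?w ?low)"
      by (simp only: levels_ord_ge ord_level_weight_0 ord_block_col)
    have 2: "ord_ge m (sum ?w (F - ?low))"
      using F by (intro ord_ge_sum ord_path_weight) (auto simp: SE_paths_eq)
    have "sum ?w F = sum ?w (F - ?low) + sum ?w ?low"
      using F by (simp add: sum.subset_diff)
    then have "sum ?w F - moment_col a b c d k n
        = sum ?w (F - ?low) - (moment_col a b c d k n - sum ?w ?low)"
      by simp
    then have "ord_ge m (sum ?w F - moment_col a b c d k n)"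
      by (simp only: ord_ge_diff[OF 2 1])
    then show ?thesis
      using dist_le_if_ord_ge m by fastforce
  qed
  then show "\<forall>\<^sub>F F in finite_subsets_at_top (SE_paths k n).
      dist (sum ?w F) (moment_col a b c d k n) < e"
    unfolding eventually_finite_subsets_at_top
    using sub finite_low_paths by (intro exI[of _ ?low]) auto
qed

end

end

section \<open>Specialisation to the indeterminates\<close>

lemma Fract_power: "Fract p 1 ^ n = Fract (p ^ n) 1"
  by (induction n) (simp_all add: One_fract_def)

lemma generic_X_q: "generic_q X_q"
proof
  show "X_q \<noteq> 0"
    by (simp add: X_q_def Zero_fract_def eq_fract)
  show "X_q ^ Suc m \<noteq> 1" for m
  proof
    assume "X_q ^ Suc m = 1"
    then have "Fract [:0, 1 :: rat:] 1 ^ Suc m = 1"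
      unfolding X_q_def by (simp only: fls_const_power[symmetric] fls_const_eq_1_iff)
    then have "[:0, 1 :: rat:] ^ Suc m = 1"
      unfolding Fract_power One_fract_def by (simp add: eq_fract del: power_Suc)
    \<comment> \<open>Evaluation at 0 distinguishes a positive power of the indeterminate from
      1.\<close>
    then have "poly ([:0, 1 :: rat:] ^ Suc m) 0 = 1"
      by (simp only: poly_1)
    then show False by simp
  qed
qed

theorem theorem5p3:
  fixes n k :: nat
  assumes "k \<le> n"
  shows "path_weight (w_AWH X_a X_b X_c X_d X_q) summable_on SE_paths k n
    \<and> lh_sum (w_AWH X_a X_b X_c X_d X_q) n k
        = mixed_moment (askey_wilson X_a X_b X_c X_d X_q) (q_hermite X_q) n k"
proof -
  interpret generic_q_top X_q
    by (simp add: generic_q_top_def generic_X_q)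
  interpret generic_q_fls X_q
    by (simp add: generic_q_fls_def generic_q_fls_axioms_def generic_X_q) (simp add: X_q_def)
  have ord: "ord_ge 1 X_a" "ord_ge 0 X_b" "ord_ge 0 X_c" "ord_ge 0 X_d" and a: "X_a \<noteq> 0"
    by (simp_all add: X_a_def X_b_def X_c_def X_d_def) (simp add: ord_ge_def)
  \<comment> \<open>Such a product has positive order in a, so its constant coefficient is 0. This
    supplies the conditions on ab, ac and ad.\<close>
  have neq: "X_a * y * X_q ^ m \<noteq> 1" if "ord_ge 0 y" for y m
  proof -
    have "ord_ge 1 (X_q ^ m * (y * X_a))"
      by (intro ord_ge_mult_0 ord_ge_power_0 ord_q that ord)
    then show ?thesis
      by (auto simp: ord_ge_def mult_ac dest: spec[of _ 0])
  qed
  have "mixed_moment (askey_wilson X_a X_b X_c X_d X_q) (q_hermite X_q) n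
      = (\<lambda>k. moment_col X_a X_b X_c X_d k n)"
    by (rule mixed_moment_eq_moment_col) (use neq ord a abcd_neq_1[OF a ord] in auto)
  then show ?thesis
    using has_sum_path_weight[OF a ord, of k n]
    by (auto simp: lh_sum_def summable_on_def infsumI)
qed

end
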